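(* There exists $\Delta_0>0$ such that for all integers $\Delta\geq\Delta_0$ there exists a leaf joined tree $\hat{T}$, obtained from a tree $T$ of maximum degree $\Delta$, and a complex number $q$ with $\Re(q)>\Delta$ such that $Z(\hat{T};q)=0$.
   Context: The chromatic polynomial of a finite graph $G=(V,E)$ (multiple edges allowed) is $Z(G;q)=\sum_{F\subseteq E}(-1)^{|F|}q^{k(F)}$, where $k(F)$ is the number of connected components of the graph $(V,F)$. A leaf joined tree is a graph $\hat{T}$ obtained from a rooted tree $(T,v)$ by identifying all leaves of $T$, except $v$ (in case the root $v$ is itself a leaf), into a single vertex. (All edges of $T$ are kept; multiple edges may arise.) *)

theory Defs
  imports Complex_Main
begin

record ('v, 'e) multigraph =
  vertices :: "'v set"
  edges :: "'e set"
  ends :: "'e \<Rightarrow> 'v set"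

text \<open>Distinct edges may have the same ends; an edge with a single end is a loop.\<close>

definition finite_multigraph :: "('v, 'e) multigraph \<Rightarrow> bool" where
  "finite_multigraph G \<longleftrightarrow> finite (vertices G) \<and> finite (edges G) \<and>
     (\<forall>e\<in>edges G. ends G e \<subseteq> vertices G \<and> card (ends G e) \<in> {1, 2})"

definition adjacency :: "('v, 'e) multigraph \<Rightarrow> 'v rel" where
  "adjacency G = {(u, w). \<exists>e\<in>edges G. ends G e = {u, w}}"

definition conn_components :: "('v, 'e) multigraph \<Rightarrow> 'v set set" where
  "conn_components G = vertices G // ((adjacency G)\<^sup>* \<inter> vertices G \<times> vertices G)"

definition chromatic_poly :: "('v, 'e) multigraph \<Rightarrow> complex \<Rightarrow> complex" where
  "chromatic_poly G q =
     (\<Sum>F\<in>Pow (edges G). (-1) ^ card F * q ^ card (conn_components (G\<lparr>edges := F\<rparr>)))"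

text \<open>A loop contributes 2 to the degree of its end.\<close>

definition vertex_degree :: "('v, 'e) multigraph \<Rightarrow> 'v \<Rightarrow> nat" where
  "vertex_degree G v =
     card {e \<in> edges G. v \<in> ends G e} + card {e \<in> edges G. ends G e = {v}}"

definition max_degree :: "('v, 'e) multigraph \<Rightarrow> nat" where
  "max_degree G = Max (vertex_degree G ` vertices G)"

text \<open>
  Cycles of length 1 (a loop) and of length 2 (two parallel edges) are included, so that an
  acyclic multigraph is a simple graph.
\<close>

definition is_cycle :: "('v, 'e) multigraph \<Rightarrow> 'v list \<Rightarrow> 'e list \<Rightarrow> bool" where
  "is_cycle G vs es \<longleftrightarrow> vs \<noteq> [] \<and> length es = length vs \<and> distinct vs \<and> distinct es \<and>
     set vs \<subseteq> vertices G \<and> set es \<subseteq> edges G \<and>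
     (\<forall>i<length vs. ends G (es ! i) = {vs ! i, vs ! (Suc i mod length vs)})"

definition is_tree :: "('v, 'e) multigraph \<Rightarrow> bool" where
  "is_tree T \<longleftrightarrow> finite_multigraph T \<and> card (conn_components T) = 1 \<and>
     (\<nexists>vs es. is_cycle T vs es)"

definition rooted_tree :: "('v, 'e) multigraph \<Rightarrow> 'v \<Rightarrow> bool" where
  "rooted_tree T v \<longleftrightarrow> is_tree T \<and> v \<in> vertices T"

definition leaves :: "('v, 'e) multigraph \<Rightarrow> 'v set" where
  "leaves T = {u \<in> vertices T. vertex_degree T u = 1}"

text \<open>
  The vertices of the quotient graph are the classes of the partition of the old vertex set
  into \<open>S\<close> and the singletons outside \<open>S\<close>; the edge set is unchanged.
\<close>

definition identify :: "'v set \<Rightarrow> ('v, 'e) multigraph \<Rightarrow> ('v set, 'e) multigraph" where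
  "identify S G =
     (let cls = (\<lambda>u. if u \<in> S then S else {u})
      in \<lparr>vertices = cls ` vertices G, edges = edges G, ends = (\<lambda>e. cls ` ends G e)\<rparr>)"

definition leaf_joined_tree :: "('v, 'e) multigraph \<Rightarrow> 'v \<Rightarrow> ('v set, 'e) multigraph" where
  "leaf_joined_tree T v = identify (leaves T - {v}) T"

lemma finite_multigraph_identify:
  assumes "finite_multigraph G"
  shows "finite_multigraph (identify S G)"
proof -
  have "card (f ` A) \<in> {1, 2}" if "card A \<in> {1, 2}" for f :: "'a \<Rightarrow> 'a set" and A :: "'a set"
  proof -
    have "finite A" "A \<noteq> {}"
      using that by (auto intro: card_ge_0_finite)
    then have "card (f ` A) \<le> 2" "card (f ` A) \<noteq> 0"
      using that card_image_le[of A f] by auto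
    then show ?thesis by auto
  qed
  note card_img = this
  define cls where "cls = (\<lambda>u. if u \<in> S then S else {u})"
  have eq: "identify S G =
      \<lparr>vertices = cls ` vertices G, edges = edges G, ends = (\<lambda>e. cls ` ends G e)\<rparr>"
    unfolding identify_def cls_def Let_def by (rule refl)
  show ?thesis
    using assms card_img[of _ cls] unfolding finite_multigraph_def eq
    by (simp del: insert_iff add: image_mono)
qed

end

theory Submission
  imports Defs "HOL-Complex_Analysis.Complex_Analysis" "HOL-Real_Asymp.Real_Asymp"
begin

text \<open>
  Write \<open>q = 1 + x\<close>. Below a vertex of a rooted tree the colourings are summarised by two weights:
  their number when the vertex shares the colour of the joined leaf, and their number when it
  does not. With \<open>R\<close> the quotient of the two weights at the root, the chromatic polynomial of the
  leaf joined tree vanishes if \<open>R = - x\<close>. If a vertex has children with quotients \<open>R\<^sub>i\<close>, then its own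
  quotient is the product of the factors \<open>x / (x - 1 + R\<^sub>i)\<close>. Substituting \<open>x = \<Delta> / \<mu>\<close> and \<open>z = \<mu> (1 - R)\<close>
  (the defect) turns the factors into \<open>1 / (1 - z\<^sub>i / \<Delta>)\<close>, so that for large \<open>\<Delta>\<close>
  a vertex with \<open>s\<^sub>i \<Delta>\<close> children of defect \<open>z\<^sub>i\<close>, where the \<open>s\<^sub>i\<close> have sum at most 1, has a defect
  close to \<open>\<mu> (1 - exp (\<Sum>i. s\<^sub>i z\<^sub>i))\<close>. The condition on \<open>q\<close> holds as soon as \<open>Re (1 / \<mu>) \<ge> 1\<close>.

  Three things are needed. First, at one admissible parameter \<open>\<mu>\<^sub>0\<close> the defects must be able to
  become large. The map \<open>z \<mapsto> \<mu> (1 - exp z)\<close> fixes 0 with multiplier \<open>- \<mu>\<close>, which is attracting but, near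
  \<open>\<mu> = 1\<close>, only weakly so: orbits turn around 0 without shrinking much, and mixing in a few copies of
  the initial defect \<open>\<mu>\<close> is enough to push one of them out. A chain of 29 steps at \<open>\<mu>\<^sub>0 = 0.975 - 0.156 i\<close>
  is verified in integer ball arithmetic (\<open>escape_chain\<close>, \<open>eventually_reachable_in_sector\<close>). Secondly, once
  a defect is moderately large, the number of copies can be chosen so that the exponential has any
  desired direction; iterating this gives defects beyond any fixed multiple of \<open>ln \<Delta>\<close> in a prescribed
  direction (\<open>growth_step\<close>, \<open>reachable_far\<close>).

  Finally, suppose that there were no zero for any \<open>\<mu>\<close> in a fixed disc around \<open>\<mu>\<^sub>0\<close>. Then all defects
  are holomorphic there, and for every \<open>m \<le> \<Delta>\<close> the function \<open>- \<mu> / \<Delta> (1 - z / \<Delta>) ^ (- m)\<close> omits 0 and 1,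
  the value 1 being a zero of the chromatic polynomial. If \<open>Re z \<ge> 2 ln \<Delta>\<close>, then \<open>m\<close> can be chosen such that
  the modulus at \<open>\<mu>\<^sub>0\<close> is close to 1. Schottky's theorem and Cauchy's estimate bound its logarithmic
  derivative, and this gives \<open>z' = O (Re z / ln \<Delta>)\<close> at \<open>\<mu>\<^sub>0\<close> (\<open>defect_derivative_bound\<close>). Apply this to a forest
  and to two copies of it side by side, whose defect is \<open>2 z - z\<^sup>2 / \<mu>\<close>. The derivative of the latter contains
  the term \<open>z\<^sup>2 / \<mu>\<^sup>2\<close>, whereas all other terms and the derivative itself are \<open>O (z\<^sup>2 / ln \<Delta>)\<close>. For large \<open>\<Delta>\<close>
  this is a contradiction (\<open>eventually_not_zero_free\<close>).
\<close>

section \<open>Chromatic polynomials as counts of proper colourings\<close>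

definition constant_on_set :: "('a \<Rightarrow> 'b) \<Rightarrow> 'a set \<Rightarrow> bool" where
  "constant_on_set c A \<longleftrightarrow> (\<forall>u\<in>A. \<forall>w\<in>A. c u = c w)"

text \<open>
  Functions on an image are functions on the domain that do not separate points with equal image.
  With \<open>f\<close> sending a vertex to its component this counts colourings constant on components; with \<open>f\<close>
  sending a vertex to its class it compares colourings before and after identifying vertices.
\<close>

lemma bij_betw_PiE_image:
  fixes f :: "'a \<Rightarrow> 'b" and C :: "'c set"
  shows "bij_betw (\<lambda>g. restrict (g \<circ> f) V) (f ` V \<rightarrow>\<^sub>E C)
           {c \<in> V \<rightarrow>\<^sub>E C. \<forall>u\<in>V. \<forall>w\<in>V. f u = f w \<longrightarrow> c u = c w}"
    (is "bij_betw ?h ?A ?B")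
  unfolding bij_betw_def
proof (intro conjI subset_antisym subsetI)
  show "inj_on ?h ?A"
  proof (rule inj_onI)
    fix g g' assume g: "g \<in> ?A" "g' \<in> ?A" "?h g = ?h g'"
    show "g = g'"
    proof (rule PiE_ext[OF g(1,2)])
      fix X assume "X \<in> f ` V"
      then show "g X = g' X" using fun_cong[OF g(3)] by (metis comp_apply image_iff restrict_apply')
    qed
  qed
next
  fix c assume "c \<in> ?h ` ?A"
  then show "c \<in> ?B" by auto
next
  fix c assume c: "c \<in> ?B"
  define g where "g = (\<lambda>X\<in>f ` V. c (inv_into V f X))"
  have "g \<in> ?A"
    using c by (auto simp: g_def PiE_mem inv_into_into)
  moreover have "?h g = c"
  proof (rule ext)
    fix v show "?h g v = c v"
    proof (cases "v \<in> V")
      case True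
      then have "inv_into V f (f v) \<in> V" "f (inv_into V f (f v)) = f v"
        by (auto simp: inv_into_into f_inv_into_f)
      then have "c (inv_into V f (f v)) = c v" using c True by blast
      then show ?thesis using True by (simp add: g_def)
    next
      case False
      then show ?thesis using c by (auto simp: PiE_def extensional_def)
    qed
  qed
  ultimately show "c \<in> ?h ` ?A" by blast
qed

lemma card_constant_on_components:
  assumes G: "finite_multigraph G" and "finite C"
  shows "card {c \<in> vertices G \<rightarrow>\<^sub>E C. \<forall>e\<in>edges G. constant_on_set c (ends G e)}
           = card C ^ card (conn_components G)"
proof -
  define V where "V = vertices G"
  define R where "R = (adjacency G)\<^sup>* \<inter> V \<times> V"
  have finV: "finite V" using G by (simp add: finite_multigraph_def V_def)
  have symA: "sym (adjacency G)"
    by (auto simp: sym_def adjacency_def insert_commute)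
  have eqR: "equiv V R"
  proof (rule equivI)
    show "R \<subseteq> V \<times> V" by (auto simp: R_def)
    show "refl_on V R" by (auto simp: refl_on_def R_def)
    show "sym R" using sym_rtrancl[OF symA] by (auto simp: R_def sym_def)
    show "trans R" by (auto simp: R_def trans_def intro: rtrancl_trans)
  qed
  define f where "f = (\<lambda>v. R `` {v})"
  have fV: "f ` V = conn_components G"
    by (auto simp: f_def conn_components_def quotient_def R_def V_def)
  have "{c \<in> V \<rightarrow>\<^sub>E C. \<forall>e\<in>edges G. constant_on_set c (ends G e)}
      = {c \<in> V \<rightarrow>\<^sub>E C. \<forall>u\<in>V. \<forall>w\<in>V. f u = f w \<longrightarrow> c u = c w}" (is "?L = ?R")
  proof (intro Collect_cong conj_cong refl iffI ballI impI)
    fix c u w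
    assume c: "\<forall>e\<in>edges G. constant_on_set c (ends G e)" and uw: "u \<in> V" "w \<in> V" "f u = f w"
    have "(u, w) \<in> (adjacency G)\<^sup>*"
      using eq_equiv_class[OF uw(3)[unfolded f_def] eqR uw(2)] by (simp add: R_def)
    then show "c u = c w"
    proof (induction rule: rtrancl_induct)
      case (step y z)
      then obtain e where "e \<in> edges G" "ends G e = {y, z}" by (auto simp: adjacency_def)
      then have "c y = c z" using c by (auto simp: constant_on_set_def)
      then show ?case using step by simp
    qed simp
  next
    fix c e
    assume c: "\<forall>u\<in>V. \<forall>w\<in>V. f u = f w \<longrightarrow> c u = c w" and e: "e \<in> edges G"
    have sub: "ends G e \<subseteq> V" and card: "card (ends G e) \<in> {1, 2}"
      using G e by (auto simp: finite_multigraph_def V_def)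
    show "constant_on_set c (ends G e)"
      unfolding constant_on_set_def
    proof (intro ballI)
      fix u w assume u: "u \<in> ends G e" and w: "w \<in> ends G e"
      show "c u = c w"
      proof (cases "u = w")
        case False
        have "ends G e = {u, w}"
        proof (rule sym, rule card_seteq)
          show "finite (ends G e)" using card by (auto intro: card_ge_0_finite)
          show "card (ends G e) \<le> card {u, w}" using card False by auto
        qed (use u w in auto)
        then have "(u, w) \<in> adjacency G" using e by (auto simp: adjacency_def)
        then have "(u, w) \<in> R" using sub u w by (auto simp: R_def)
        then have "f u = f w" unfolding f_def by (rule equiv_class_eq[OF eqR])
        then show ?thesis using c sub u w by blast
      qed simp
    qed
  qed
  then have "card ?L = card (f ` V \<rightarrow>\<^sub>E C)"
    using bij_betw_same_card[OF bij_betw_PiE_image[of f V C]] by simp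
  also have "\<dots> = card C ^ card (f ` V)"
    using finV by (simp add: card_PiE)
  finally show ?thesis unfolding fV by (simp add: V_def)
qed

lemma sum_Pow_alternating:
  assumes "finite S"
  shows "(\<Sum>F\<in>Pow S. (-1) ^ card F) = (if S = {} then 1 else 0 :: complex)"
proof (cases "S = {}")
  case False
  then obtain x where x: "x \<in> S" by blast
  define S' where "S' = S - {x}"
  have S: "S = insert x S'" "x \<notin> S'" "finite S'" using x assms by (auto simp: S'_def)
  have inj: "inj_on (insert x) (Pow S')" using S(2) by (auto simp: inj_on_def)
  have "(\<Sum>F\<in>Pow S. (-1) ^ card F)
      = (\<Sum>F\<in>Pow S'. (-1) ^ card F) + (\<Sum>F\<in>insert x ` Pow S'. (-1) ^ card F :: complex)"
    unfolding S(1) Pow_insert using S by (intro sum.union_disjoint) auto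
  also have "(\<Sum>F\<in>insert x ` Pow S'. (-1) ^ card F :: complex) = (\<Sum>F\<in>Pow S'. (-1) ^ card (insert x F))"
    using inj by (simp add: sum.reindex)
  also have "\<dots> = (\<Sum>F\<in>Pow S'. - ((-1) ^ card F))"
    using S by (intro sum.cong refl) (subst card_insert_disjoint, auto intro: finite_subset)
  finally show ?thesis using False by (simp add: sum_negf)
qed simp

text \<open>
  The power \<open>m ^ k(F)\<close> counts the maps to \<open>m\<close> colours that are constant on every edge of \<open>F\<close>. After exchanging
  the sums, each map contributes the alternating sum over all sets of its monochromatic edges,
  which vanishes unless there is no such edge.
\<close>

theorem chromatic_poly_counts_proper_colourings:
  assumes G: "finite_multigraph G"
  shows "chromatic_poly G (of_nat m) =
    of_nat (card {c \<in> vertices G \<rightarrow>\<^sub>E {..<m}. \<forall>e\<in>edges G. \<not> constant_on_set c (ends G e)})"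
proof -
  define P where "P = (vertices G \<rightarrow>\<^sub>E {..<m})"
  define mono where "mono = (\<lambda>c :: 'a \<Rightarrow> nat. {e \<in> edges G. constant_on_set c (ends G e)})"
  have finE: "finite (edges G)" and finV: "finite (vertices G)"
    using G by (auto simp: finite_multigraph_def)
  have finP: "finite P" unfolding P_def using finV by (intro finite_PiE) auto
  have comp: "of_nat m ^ card (conn_components (G\<lparr>edges := F\<rparr>))
      = (\<Sum>c\<in>P. if F \<subseteq> mono c then 1 else 0 :: complex)" if F: "F \<in> Pow (edges G)" for F
  proof -
    have "finite_multigraph (G\<lparr>edges := F\<rparr>)"
      using G F by (auto simp: finite_multigraph_def intro: finite_subset)
    from card_constant_on_components[OF this, of "{..<m}"]
    have "card {c \<in> P. \<forall>e\<in>F. constant_on_set c (ends G e)} = m ^ card (conn_components (G\<lparr>edges := F\<rparr>))"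
      by (simp add: P_def)
    moreover have "{c \<in> P. \<forall>e\<in>F. constant_on_set c (ends G e)} = {c \<in> P. F \<subseteq> mono c}"
      using F by (auto simp: mono_def)
    ultimately have "of_nat m ^ card (conn_components (G\<lparr>edges := F\<rparr>)) = (of_nat (card {c \<in> P. F \<subseteq> mono c}) :: complex)"
      by (metis of_nat_power)
    also have "\<dots> = (\<Sum>c\<in>P. if F \<subseteq> mono c then 1 else 0)"
      using finP by (simp flip: sum.inter_filter)
    finally show ?thesis .
  qed
  have "chromatic_poly G (of_nat m)
      = (\<Sum>F\<in>Pow (edges G). \<Sum>c\<in>P. if F \<subseteq> mono c then (-1) ^ card F else 0)"
    unfolding chromatic_poly_def
    by (intro sum.cong refl, subst comp, assumption, subst sum_distrib_left, intro sum.cong refl) simp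
  also have "\<dots> = (\<Sum>c\<in>P. \<Sum>F\<in>Pow (edges G). if F \<subseteq> mono c then (-1) ^ card F else 0)"
    by (rule sum.swap)
  also have "\<dots> = (\<Sum>c\<in>P. \<Sum>F\<in>Pow (mono c). (-1) ^ card F)"
  proof (rule sum.cong[OF refl])
    fix c assume "c \<in> P"
    have "{F \<in> Pow (edges G). F \<subseteq> mono c} = Pow (mono c)" by (auto simp: mono_def)
    then show "(\<Sum>F\<in>Pow (edges G). if F \<subseteq> mono c then (-1) ^ card F else 0)
        = (\<Sum>F\<in>Pow (mono c). (-1) ^ card F :: complex)"
      using finE by (simp flip: sum.inter_filter)
  qed
  also have "\<dots> = (\<Sum>c\<in>P. if mono c = {} then 1 else 0)"
    using finE by (intro sum.cong refl sum_Pow_alternating) (simp add: mono_def)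
  also have "\<dots> = of_nat (card {c \<in> P. mono c = {}})"
    using finP by (simp flip: sum.inter_filter)
  also have "{c \<in> P. mono c = {}} = {c \<in> P. \<forall>e\<in>edges G. \<not> constant_on_set c (ends G e)}"
    by (auto simp: mono_def)
  finally show ?thesis by (simp add: P_def)
qed

lemma image_Collect_comp: "h ` {g \<in> X. P (h g)} = {c \<in> h ` X. P c}"
  by blast

lemma chromatic_poly_identify:
  assumes G: "finite_multigraph G" and S: "S \<subseteq> vertices G"
  shows "chromatic_poly (identify S G) (of_nat m) =
    of_nat (card {c \<in> vertices G \<rightarrow>\<^sub>E {..<m}. constant_on_set c S \<and>
                    (\<forall>e\<in>edges G. \<not> constant_on_set c (ends G e))})"
proof -
  define cls where "cls = (\<lambda>u. if u \<in> S then S else {u})"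
  define V where "V = vertices G"
  have eq: "identify S G = \<lparr>vertices = cls ` V, edges = edges G, ends = (\<lambda>e. cls ` ends G e)\<rparr>"
    unfolding identify_def cls_def Let_def V_def by (rule refl)
  have cls: "cls u = cls w \<longleftrightarrow> u = w \<or> u \<in> S \<and> w \<in> S" for u w
    by (auto simp: cls_def)
  have sub: "ends G e \<subseteq> V" if "e \<in> edges G" for e
    using G that by (auto simp: finite_multigraph_def V_def)
  have const: "constant_on_set (restrict (g \<circ> cls) V) (ends G e) \<longleftrightarrow> constant_on_set g (cls ` ends G e)"
    if "e \<in> edges G" for e and g :: "'a set \<Rightarrow> nat"
    using sub[OF that] by (auto simp: constant_on_set_def subset_iff)
  define A where "A = {g \<in> cls ` V \<rightarrow>\<^sub>E {..<m}. \<forall>e\<in>edges G. \<not> constant_on_set g (cls ` ends G e)}"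
  define B where "B = {c \<in> V \<rightarrow>\<^sub>E {..<m}. constant_on_set c S \<and>
                         (\<forall>e\<in>edges G. \<not> constant_on_set c (ends G e))}"
  let ?h = "\<lambda>g. restrict (g \<circ> cls) V"
  have bij: "bij_betw ?h (cls ` V \<rightarrow>\<^sub>E {..<m})
      {c \<in> V \<rightarrow>\<^sub>E {..<m}. \<forall>u\<in>V. \<forall>w\<in>V. cls u = cls w \<longrightarrow> c u = c w}"
    by (rule bij_betw_PiE_image)
  have set_eq: "{c \<in> V \<rightarrow>\<^sub>E {..<m}. \<forall>u\<in>V. \<forall>w\<in>V. cls u = cls w \<longrightarrow> c u = c w}
      = {c \<in> V \<rightarrow>\<^sub>E {..<m}. constant_on_set c S}"
    using S by (auto simp: cls constant_on_set_def V_def)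
  have surj: "?h ` (cls ` V \<rightarrow>\<^sub>E {..<m}) = {c \<in> V \<rightarrow>\<^sub>E {..<m}. constant_on_set c S}"
    using bij_betw_imp_surj_on[OF bij] unfolding set_eq .
  have const': "(\<forall>e\<in>edges G. \<not> constant_on_set (?h g) (ends G e)) \<longleftrightarrow>
      (\<forall>e\<in>edges G. \<not> constant_on_set g (cls ` ends G e))" for g :: "'a set \<Rightarrow> nat"
    using const[of _ g] by (simp only: cong: ball_cong)
  have A: "A = {g \<in> cls ` V \<rightarrow>\<^sub>E {..<m}. \<forall>e\<in>edges G. \<not> constant_on_set (?h g) (ends G e)}"
    unfolding A_def const' ..
  have B: "B = {c \<in> ?h ` (cls ` V \<rightarrow>\<^sub>E {..<m}). \<forall>e\<in>edges G. \<not> constant_on_set c (ends G e)}"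
    unfolding B_def surj mem_Collect_eq conj_assoc ..
  have "?h ` A = B" unfolding A B by (rule image_Collect_comp)
  moreover have "A \<subseteq> cls ` V \<rightarrow>\<^sub>E {..<m}" unfolding A by (rule Collect_restrict)
  ultimately have "bij_betw ?h A B" using bij_betw_subset[OF bij] by (simp only:)
  then have "card A = card B" by (rule bij_betw_same_card)
  moreover have "chromatic_poly (identify S G) (of_nat m) = of_nat (card A)"
    using chromatic_poly_counts_proper_colourings[OF finite_multigraph_identify[OF G, of S], of m]
    by (simp only: eq A_def multigraph.select_convs)
  ultimately have "chromatic_poly (identify S G) (of_nat m) = of_nat (card B)" by (simp only:)
  then show ?thesis unfolding B_def V_def .
qed

section \<open>Plane forests and their boundary weights\<close>

text \<open>
  A list of such trees is a plane forest. It describes everything strictly below a vertex \<open>p\<close>, the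
  roots of the forest being the children of \<open>p\<close>; a vertex without children is a leaf. The vertices of a
  forest are numbered in preorder, starting with \<open>s\<close>, so every forest occupies an interval.
\<close>

datatype rtree = Node "rtree list"

fun fsize :: "rtree list \<Rightarrow> nat" where
  "fsize [] = 0"
| "fsize (Node cs # ts) = Suc (fsize cs + fsize ts)"

fun par :: "nat \<Rightarrow> nat \<Rightarrow> rtree list \<Rightarrow> nat \<Rightarrow> nat" where
  "par p s [] i = 0"
| "par p s (Node cs # ts) i =
     (if i = s then p
      else if i < s + Suc (fsize cs) then par s (Suc s) cs i
      else par p (s + Suc (fsize cs)) ts i)"

fun outdegs :: "rtree list \<Rightarrow> nat set" where
  "outdegs [] = {}"
| "outdegs (Node cs # ts) = insert (length cs) (outdegs cs \<union> outdegs ts)"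

text \<open>
  The number of colourings of a forest hanging below \<open>p\<close> when all leaves carry one prescribed colour,
  as functions of \<open>x = q - 1\<close>: \<open>same_wt\<close> if \<open>p\<close> also has that colour and \<open>diff_wt\<close> if it does not. For a non-leaf
  child of \<open>p\<close> there are \<open>x\<close> colours different from that of \<open>p\<close>; in the second case one of
  them is the prescribed colour.
\<close>

fun same_wt diff_wt :: "rtree list \<Rightarrow> complex \<Rightarrow> complex" where
  "same_wt [] x = 1"
| "same_wt (Node cs # ts) x = (if cs = [] then 0 else x * diff_wt cs x) * same_wt ts x"
| "diff_wt [] x = 1"
| "diff_wt (Node cs # ts) x =
     (if cs = [] then 1 else same_wt cs x + (x - 1) * diff_wt cs x) * diff_wt ts x"

text \<open>
  Colourings are listed in preorder. Once the colour \<open>x\<close> of the first root is fixed, the blocks below it and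
  to its right are independent, which makes the counts multiplicative. Here \<open>a\<close> is the prescribed colour
  of the leaves and \<open>\<gamma>\<close> that of the vertex above the forest.
\<close>

fun colourings :: "nat \<Rightarrow> nat \<Rightarrow> nat \<Rightarrow> rtree list \<Rightarrow> nat list set" where
  "colourings m a \<gamma> [] = {[]}"
| "colourings m a \<gamma> (Node cs # ts) =
     (\<lambda>(x, ys, zs). x # ys @ zs) `
       (SIGMA x:{x. x < m \<and> x \<noteq> \<gamma> \<and> (cs = [] \<longrightarrow> x = a)}. colourings m a x cs \<times> colourings m a \<gamma> ts)"

lemma colourings_length: "xs \<in> colourings m a \<gamma> ts \<Longrightarrow> length xs = fsize ts"
  by (induction m a \<gamma> ts arbitrary: xs rule: colourings.induct) auto

lemma finite_colourings: "finite (colourings m a \<gamma> ts)"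
  by (induction m a \<gamma> ts rule: colourings.induct) (auto intro!: finite_imageI finite_SigmaI)

lemma card_colourings:
  assumes "a < m" "\<gamma> < m"
  shows "of_nat (card (colourings m a \<gamma> ts)) =
    (if \<gamma> = a then same_wt ts (of_nat m - 1) else diff_wt ts (of_nat m - 1))"
  using assms
proof (induction m a \<gamma> ts rule: colourings.induct)
  case (2 m a \<gamma> cs ts)
  define X where "X = {x. x < m \<and> x \<noteq> \<gamma> \<and> (cs = [] \<longrightarrow> x = a)}"
  have finX: "finite X" by (simp add: X_def)
  have "inj_on (\<lambda>(x, ys, zs). x # ys @ zs) (SIGMA x:X. colourings m a x cs \<times> colourings m a \<gamma> ts)"
    by (auto simp: inj_on_def dest!: colourings_length)
  then have "card (colourings m a \<gamma> (Node cs # ts)) = card (SIGMA x:X. colourings m a x cs \<times> colourings m a \<gamma> ts)"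
    unfolding colourings.simps X_def[symmetric] by (rule card_image)
  also have "\<dots> = (\<Sum>x\<in>X. card (colourings m a x cs) * card (colourings m a \<gamma> ts))"
    using finX by (simp add: finite_colourings card_cartesian_product)
  finally have card: "of_nat (card (colourings m a \<gamma> (Node cs # ts))) =
      (\<Sum>x\<in>X. of_nat (card (colourings m a x cs))) * (of_nat (card (colourings m a \<gamma> ts)) :: complex)"
    by (simp add: sum_distrib_right)
  have IH1: "of_nat (card (colourings m a x cs)) =
      (if x = a then same_wt cs (of_nat m - 1) else diff_wt cs (of_nat m - 1))" if "x \<in> X" for x
    using that 2 by (auto simp: X_def)
  have "(\<Sum>x\<in>X. of_nat (card (colourings m a x cs))) =
     (if \<gamma> = a then if cs = [] then 0 else (of_nat m - 1) * diff_wt cs (of_nat m - 1)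
      else if cs = [] then 1 else same_wt cs (of_nat m - 1) + (of_nat m - 2) * diff_wt cs (of_nat m - 1))"
  proof (cases "cs = []")
    case True
    then have "X = (if \<gamma> = a then {} else {a})" using 2 by (auto simp: X_def)
    then show ?thesis using True by simp
  next
    case False
    show ?thesis
    proof (cases "\<gamma> = a")
      case True
      have "X = {..<m} - {a}" using False True by (auto simp: X_def)
      then have "card X = m - 1" using 2 by simp
      moreover have "(\<Sum>x\<in>X. of_nat (card (colourings m a x cs))) = (\<Sum>x\<in>X. diff_wt cs (of_nat m - 1))"
        using True by (intro sum.cong refl) (subst IH1, auto simp: X_def)
      ultimately show ?thesis using False True 2 by (simp add: of_nat_diff)
    next
      case neq: False
      have X: "X = insert a ({..<m} - {a, \<gamma>})" using False neq 2 by (auto simp: X_def)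
      have "card ({..<m} - {a, \<gamma>}) = m - 2" using neq 2 by (simp add: card_Diff_subset)
      moreover have "(\<Sum>x\<in>{..<m} - {a, \<gamma>}. of_nat (card (colourings m a x cs)))
          = (\<Sum>x\<in>{..<m} - {a, \<gamma>}. diff_wt cs (of_nat m - 1))"
        by (intro sum.cong refl) (subst IH1, auto simp: X)
      moreover have "2 \<le> m" using neq 2 by linarith
      moreover have "a \<in> X" by (simp add: X)
      ultimately show ?thesis using False neq IH1[of a] unfolding X
        by (subst sum.insert) (auto simp: of_nat_diff)
    qed
  qed
  then show ?case using 2 card by simp
qed simp

lemma par_bounds:
  assumes "p < s" "i \<in> {s..<s + fsize ts}"
  shows "par p s ts i < i" "par p s ts i = p \<or> par p s ts i \<in> {s..<s + fsize ts}"
proof -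
  have "par p s ts i < i \<and> (par p s ts i = p \<or> par p s ts i \<in> {s..<s + fsize ts})"
    using assms
  proof (induction p s ts i rule: par.induct)
    case (2 p s cs ts i)
    consider "i = s" | "i \<in> {Suc s..<Suc s + fsize cs}"
      | "i \<in> {s + Suc (fsize cs)..<s + Suc (fsize cs) + fsize ts}"
      using "2.prems" by fastforce
    then show ?case
    proof cases
      case 2 then show ?thesis using "2.IH"(1) by (auto simp del: par.simps(1))
    next
      case 3 then show ?thesis using "2.IH"(2) "2.prems" by fastforce
    qed (use "2.prems" in auto)
  qed simp
  then show "par p s ts i < i" "par p s ts i = p \<or> par p s ts i \<in> {s..<s + fsize ts}" by auto
qed


definition kids :: "nat \<Rightarrow> nat \<Rightarrow> rtree list \<Rightarrow> nat \<Rightarrow> nat set" where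
  "kids p s ts i = {j \<in> {s..<s + fsize ts}. par p s ts j = i}"

lemma block_Cons:
  "{s..<s + fsize (Node cs # ts)} =
     insert s ({Suc s..<Suc s + fsize cs} \<union> {s + Suc (fsize cs)..<s + Suc (fsize cs) + fsize ts})"
  by auto

lemma kids_Cons:
  assumes "p < s"
  shows "kids p s (Node cs # ts) p = insert s (kids p (s + Suc (fsize cs)) ts p)"
    and "kids p s (Node cs # ts) s = kids s (Suc s) cs s"
    and "i \<in> {Suc s..<Suc s + fsize cs} \<Longrightarrow> kids p s (Node cs # ts) i = kids s (Suc s) cs i"
    and "i \<in> {s + Suc (fsize cs)..<s + Suc (fsize cs) + fsize ts} \<Longrightarrow>
           kids p s (Node cs # ts) i = kids p (s + Suc (fsize cs)) ts i"
proof -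
  define s' where "s' = s + Suc (fsize cs)"
  have split: "j \<in> kids p s (Node cs # ts) i \<longleftrightarrow>
      j = s \<and> i = p \<or> j \<in> kids s (Suc s) cs i \<or> j \<in> kids p s' ts i" for i j
    by (auto simp: kids_def s'_def)
  have cs: "i = s \<or> i \<in> {Suc s..<Suc s + fsize cs}" if "j \<in> kids s (Suc s) cs i" for i j
    using that par_bounds(2)[of s "Suc s" j cs] by (auto simp: kids_def)
  have ts: "i = p \<or> i \<in> {s'..<s' + fsize ts}" if "j \<in> kids p s' ts i" for i j
    using that par_bounds(2)[of p s' j ts] assms by (auto simp: kids_def s'_def)
  show "kids p s (Node cs # ts) p = insert s (kids p (s + Suc (fsize cs)) ts p)"
    using split[of _ p] cs[of _ p] assms unfolding s'_def[symmetric] by fastforce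
  show "kids p s (Node cs # ts) s = kids s (Suc s) cs s"
    using split[of _ s] ts[of _ s] assms s'_def by fastforce
  show "kids p s (Node cs # ts) i = kids s (Suc s) cs i" if "i \<in> {Suc s..<Suc s + fsize cs}"
    using split[of _ i] ts[of _ i] that assms s'_def by fastforce
  show "kids p s (Node cs # ts) i = kids p (s + Suc (fsize cs)) ts i"
    if "i \<in> {s + Suc (fsize cs)..<s + Suc (fsize cs) + fsize ts}"
    using split[of _ i] cs[of _ i] that assms unfolding s'_def[symmetric] by (fastforce simp: s'_def)
qed

lemma finite_kids: "finite (kids p s ts i)"
  by (simp add: kids_def)

lemma card_kids_root: "p < s \<Longrightarrow> card (kids p s ts p) = length ts"
proof (induction ts arbitrary: s)
  case (Cons t ts)
  obtain cs where t: "t = Node cs" by (cases t)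
  have "s \<notin> kids p (s + Suc (fsize cs)) ts p" by (auto simp: kids_def)
  then show ?case using Cons by (simp add: t kids_Cons(1) finite_kids)
qed (simp add: kids_def)

lemma outdegs_kids:
  "p < s \<Longrightarrow> (\<lambda>i. card (kids p s ts i)) ` {s..<s + fsize ts} = outdegs ts"
proof (induction ts arbitrary: p s rule: fsize.induct)
  case (2 cs ts)
  let ?c = "\<lambda>i. card (kids p s (Node cs # ts) i)" and ?s = "s + Suc (fsize cs)"
  have "?c ` {Suc s..<Suc s + fsize cs} = outdegs cs"
    using "2.IH"(1)[of s "Suc s"] kids_Cons(3)[OF "2.prems"] by (metis (no_types, lifting) image_cong lessI)
  moreover have "?c ` {?s..<?s + fsize ts} = outdegs ts"
    using "2.IH"(2)[of p ?s] kids_Cons(4)[OF "2.prems"] "2.prems"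
    by (metis (no_types, lifting) image_cong trans_less_add1)
  moreover have "?c s = length cs"
    using kids_Cons(2)[OF "2.prems"] card_kids_root[of s "Suc s" cs] by simp
  ultimately show ?case
    unfolding block_Cons image_insert image_Un by simp
qed simp

text \<open>
  Translates the recursive description of colour lists into conditions on the individual vertices
  and edges, which is the form in which the graph presents them.
\<close>

lemma map_in_colourings:
  assumes "p < s"
  shows "map c [s..<s + fsize ts] \<in> colourings m a (c p) ts \<longleftrightarrow>
    (\<forall>i\<in>{s..<s + fsize ts}. c i < m \<and> c i \<noteq> c (par p s ts i) \<and> (kids p s ts i = {} \<longrightarrow> c i = a))"
  using assms
proof (induction ts arbitrary: p s rule: fsize.induct)
  case (2 cs ts)
  let ?s = "s + Suc (fsize cs)"
  have upt: "[s..<s + fsize (Node cs # ts)] = s # [Suc s..<Suc s + fsize cs] @ [?s..<?s + fsize ts]"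
    using upt_conv_Cons[of s "s + fsize (Node cs # ts)"]
      upt_add_eq_append[of "Suc s" "Suc s + fsize cs" "fsize ts"] by (simp add: add.assoc)
  have kids_s: "kids s (Suc s) cs s = {} \<longleftrightarrow> cs = []"
    using card_kids_root[of s "Suc s" cs] finite_kids[of s "Suc s" cs s] by auto
  have len: "ys \<in> colourings m a x cs \<Longrightarrow> length ys = fsize cs" for ys x
    by (rule colourings_length)
  have "map c [s..<s + fsize (Node cs # ts)] \<in> colourings m a (c p) (Node cs # ts) \<longleftrightarrow>
      c s < m \<and> c s \<noteq> c p \<and> (cs = [] \<longrightarrow> c s = a) \<and>
      map c [Suc s..<Suc s + fsize cs] \<in> colourings m a (c s) cs \<and>
      map c [?s..<?s + fsize ts] \<in> colourings m a (c p) ts" (is "?L \<longleftrightarrow> ?R")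
  proof
    assume ?L
    then obtain ys zs where "c s < m" "c s \<noteq> c p" "cs = [] \<longrightarrow> c s = a"
      and ys: "ys \<in> colourings m a (c s) cs" and zs: "zs \<in> colourings m a (c p) ts"
      and eq: "map c [Suc s..<Suc s + fsize cs] @ map c [?s..<?s + fsize ts] = ys @ zs"
      unfolding upt by auto
    moreover have "map c [Suc s..<Suc s + fsize cs] = ys \<and> map c [?s..<?s + fsize ts] = zs"
      using eq len[OF ys] by (subst (asm) append_eq_append_conv) auto
    ultimately show ?R by blast
  next
    assume ?R
    then show ?L unfolding upt by (auto simp: image_iff simp del: upt_Suc)
  qed
  also have "\<dots> \<longleftrightarrow> (\<forall>i\<in>{s..<s + fsize (Node cs # ts)}. c i < m \<and> c i \<noteq> c (par p s (Node cs # ts) i) \<and>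
                     (kids p s (Node cs # ts) i = {} \<longrightarrow> c i = a))"
  proof -
    have par: "par p s (Node cs # ts) i = par s (Suc s) cs i" if "i \<in> {Suc s..<Suc s + fsize cs}" for i
      using that by simp
    have par': "par p s (Node cs # ts) i = par p ?s ts i" if "i \<in> {?s..<?s + fsize ts}" for i
      using that by simp
    have eqs: "(\<forall>i\<in>{Suc s..<Suc s + fsize cs}. c i < m \<and> c i \<noteq> c (par s (Suc s) cs i) \<and>
          (kids s (Suc s) cs i = {} \<longrightarrow> c i = a)) \<longleftrightarrow>
        (\<forall>i\<in>{Suc s..<Suc s + fsize cs}. c i < m \<and> c i \<noteq> c (par p s (Node cs # ts) i) \<and>
          (kids p s (Node cs # ts) i = {} \<longrightarrow> c i = a))"
      "(\<forall>i\<in>{?s..<?s + fsize ts}. c i < m \<and> c i \<noteq> c (par p ?s ts i) \<and>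
          (kids p ?s ts i = {} \<longrightarrow> c i = a)) \<longleftrightarrow>
        (\<forall>i\<in>{?s..<?s + fsize ts}. c i < m \<and> c i \<noteq> c (par p s (Node cs # ts) i) \<and>
          (kids p s (Node cs # ts) i = {} \<longrightarrow> c i = a))"
      using par par' kids_Cons(3,4)[OF "2.prems", of _ cs ts] by (metis (no_types, lifting))+
    have head: "par p s (Node cs # ts) s = p" by simp
    show ?thesis
      unfolding block_Cons ball_Un ball_simps "2.IH"(1)[OF lessI, of s]
        "2.IH"(2)[of p ?s, OF trans_less_add1[OF "2.prems"]] eqs kids_Cons(2)[OF "2.prems"] kids_s head
      by blast
  qed
  finally show ?case .
qed simp

section \<open>The leaf joined tree of a plane forest\<close>

text \<open>
  Vertex 0 is the root, and every other vertex also names the edge to its parent. Since parents have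
  smaller numbers, an edge is determined by its larger end.
\<close>

definition tree_graph :: "rtree list \<Rightarrow> (nat, nat) multigraph" where
  "tree_graph ts = \<lparr>vertices = {0..<1 + fsize ts}, edges = {1..<1 + fsize ts},
                    ends = (\<lambda>i. {par 0 1 ts i, i})\<rparr>"

lemma tree_graph_simps [simp]:
  "vertices (tree_graph ts) = {0..<1 + fsize ts}"
  "edges (tree_graph ts) = {1..<1 + fsize ts}"
  "ends (tree_graph ts) i = {par 0 1 ts i, i}"
  by (simp_all add: tree_graph_def)

lemma par_less: "i \<in> {1..<1 + fsize ts} \<Longrightarrow> par 0 1 ts i < i"
  using par_bounds(1)[of 0 1 i ts] by simp

lemma finite_multigraph_tree_graph: "finite_multigraph (tree_graph ts)"
  using par_less[of _ ts] unfolding finite_multigraph_def tree_graph_simps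
  by (fastforce simp: card_insert_if)

lemma tree_graph_connected: "card (conn_components (tree_graph ts)) = 1"
proof -
  let ?A = "adjacency (tree_graph ts)" and ?V = "vertices (tree_graph ts)"
  have edge: "(par 0 1 ts i, i) \<in> ?A" "(i, par 0 1 ts i) \<in> ?A" if "i \<in> {1..<1 + fsize ts}" for i
    using that by (auto simp: adjacency_def intro!: bexI[of _ i])
  have "(0, i) \<in> ?A\<^sup>* \<and> (i, 0) \<in> ?A\<^sup>*" if "i \<in> ?V" for i
    using that
  proof (induction i rule: less_induct)
    case (less i)
    show ?case
    proof (cases "i = 0")
      case False
      then have i: "i \<in> {1..<1 + fsize ts}" using less.prems by simp
      have IH: "(0, par 0 1 ts i) \<in> ?A\<^sup>* \<and> (par 0 1 ts i, 0) \<in> ?A\<^sup>*"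
        using par_less[OF i] less by auto
      then show ?thesis
        using edge[OF i] by (meson converse_rtrancl_into_rtrancl rtrancl.rtrancl_into_rtrancl)
    qed simp
  qed
  then have "?A\<^sup>* \<inter> ?V \<times> ?V = ?V \<times> ?V"
    by (meson inf_absorb2 mem_Sigma_iff rtrancl_trans subrelI)
  then have "conn_components (tree_graph ts) = {?V}"
    unfolding conn_components_def quotient_def by auto
  then show ?thesis by simp
qed

text \<open>
  The largest vertex on a cycle would be the larger end of both cycle edges at this vertex, so these
  edges would coincide and the cycle would be a loop.
\<close>

lemma tree_graph_acyclic: "\<not> is_cycle (tree_graph ts) vs es"
proof
  assume cyc: "is_cycle (tree_graph ts) vs es"
  define n where "n = length vs"
  have vs: "vs \<noteq> []" "distinct vs" "distinct es" "length es = n" "n > 0"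
    and E: "set es \<subseteq> {1..<1 + fsize ts}"
    and ends: "\<And>i. i < n \<Longrightarrow> {par 0 1 ts (es ! i), es ! i} = {vs ! i, vs ! (Suc i mod n)}"
    using cyc by (auto simp: is_cycle_def n_def)
  have top: "es ! i = max (vs ! i) (vs ! (Suc i mod n))" if "i < n" for i
  proof -
    have "es ! i \<in> {1..<1 + fsize ts}" using E that vs by (metis nth_mem subsetD)
    then have "par 0 1 ts (es ! i) < es ! i" by (rule par_less)
    then show ?thesis using ends[OF that] by (auto simp: doubleton_eq_iff max_def)
  qed
  obtain k where k: "k < n" "vs ! k = Max (set vs)"
    using Max_in[of "set vs"] vs(1) by (auto simp: in_set_conv_nth n_def)
  have le: "vs ! i \<le> vs ! k" if "i < n" for i
    using k(2) that by (simp add: n_def)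
  define j where "j = (k + n - 1) mod n"
  have j: "j < n" "Suc j mod n = k"
    using vs(5) k(1) by (auto simp: j_def mod_Suc_eq)
  have "es ! k = vs ! k"
    using top[OF k(1)] le[of "Suc k mod n"] vs(5) by simp
  moreover have "es ! j = vs ! k"
    using top[OF j(1)] le[OF j(1)] j(2) by simp
  ultimately have "j = k"
    using nth_eq_iff_index_eq[OF vs(3)] j(1) k(1) vs(4) by metis
  then have "{par 0 1 ts (es ! k), es ! k} = {vs ! k}"
    using ends[OF k(1)] j(2) by (metis insert_absorb2)
  moreover have "par 0 1 ts (es ! k) < es ! k"
    using E k(1) vs(4) by (metis nth_mem par_less subsetD)
  ultimately show False
    by (metis insertI1 insertI2 less_irrefl singletonD)
qed

lemma is_tree_tree_graph: "is_tree (tree_graph ts)"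
  by (simp add: is_tree_def finite_multigraph_tree_graph tree_graph_connected tree_graph_acyclic)

lemma vertex_degree_tree_graph:
  assumes "v \<in> {0..<1 + fsize ts}"
  shows "vertex_degree (tree_graph ts) v = (if v = 0 then 0 else 1) + card (kids 0 1 ts v)"
proof -
  have loops: "{e \<in> edges (tree_graph ts). ends (tree_graph ts) e = {v}} = {}"
    using par_less[of _ ts] by fastforce
  have edges: "{e \<in> edges (tree_graph ts). v \<in> ends (tree_graph ts) e}
      = (if v = 0 then {} else {v}) \<union> kids 0 1 ts v"
    using assms by (auto simp: kids_def)
  have "v \<notin> kids 0 1 ts v"
    using par_less[of v ts] by (auto simp: kids_def)
  then show ?thesis
    unfolding vertex_degree_def loops edges by (simp add: finite_kids)
qed

lemma max_degree_tree_graph: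
  "max_degree (tree_graph ts) = Max (insert (length ts) (Suc ` outdegs ts))"
proof -
  have "vertex_degree (tree_graph ts) ` {0..<1 + fsize ts}
      = insert (length ts) ((\<lambda>v. Suc (card (kids 0 1 ts v))) ` {1..<1 + fsize ts})"
  proof -
    have "{0..<1 + fsize ts} = insert 0 {1..<1 + fsize ts}" by auto
    moreover have "vertex_degree (tree_graph ts) 0 = length ts"
      using vertex_degree_tree_graph[of 0 ts] card_kids_root[of 0 1 ts] by simp
    moreover have "vertex_degree (tree_graph ts) ` {1..<1 + fsize ts}
        = (\<lambda>v. Suc (card (kids 0 1 ts v))) ` {1..<1 + fsize ts}"
      using vertex_degree_tree_graph[of _ ts] by (intro image_cong refl) auto
    ultimately show ?thesis by (metis image_insert)
  qed
  also have "(\<lambda>v. Suc (card (kids 0 1 ts v))) ` {1..<1 + fsize ts} = Suc ` outdegs ts"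
    using outdegs_kids[of 0 1 ts] by (simp add: image_image flip: image_comp) (metis image_image)
  finally show ?thesis by (simp add: max_degree_def)
qed

lemma leaves_tree_graph:
  "leaves (tree_graph ts) - {0} = {v \<in> {1..<1 + fsize ts}. kids 0 1 ts v = {}}"
  using vertex_degree_tree_graph[of _ ts] by (auto simp: leaves_def finite_kids)

text \<open>
  A proper colouring is determined by the common colour \<open>a\<close> of the leaves, the colour of the root and the
  preorder list of the others. The last vertex in preorder is always a leaf, so \<open>a\<close> can be read
  off from it. The two terms collect the colourings whose root has colour \<open>a\<close> and the rest.
\<close>

lemma chromatic_poly_leaf_joined_tree_nat:
  assumes "ts \<noteq> []"
  shows "chromatic_poly (leaf_joined_tree (tree_graph ts) 0) (of_nat m) =
    of_nat m * same_wt ts (of_nat m - 1) + of_nat m * (of_nat m - 1) * diff_wt ts (of_nat m - 1)"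
proof -
  define n where "n = fsize ts"
  define S where "S = {v \<in> {1..<1 + n}. kids 0 1 ts v = {}}"
  have n: "n > 0" using assms by (cases ts rule: fsize.cases) (auto simp: n_def)
  have "n \<in> S"
  proof -
    have "j \<notin> kids 0 1 ts n" for j using par_less[of j ts] by (auto simp: kids_def n_def)
    then show ?thesis using n by (auto simp: S_def)
  qed
  have const: "\<not> constant_on_set c {par 0 1 ts i, i} \<longleftrightarrow> c i \<noteq> c (par 0 1 ts i)" for c :: "nat \<Rightarrow> nat" and i
    by (auto simp: constant_on_set_def)
  define P where "P = {c \<in> {0..<1 + n} \<rightarrow>\<^sub>E {..<m}. constant_on_set c S \<and>
                    (\<forall>i\<in>{1..<1 + n}. c i \<noteq> c (par 0 1 ts i))}"
  define K where "K = (SIGMA a:{..<m}. SIGMA \<gamma>:{..<m}. colourings m a \<gamma> ts)"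
  let ?h = "\<lambda>c. (c n, c 0, map c [1..<1 + n])"
  have mem: "map c [1..<1 + n] \<in> colourings m a (c 0) ts \<longleftrightarrow>
      (\<forall>i\<in>{1..<1 + n}. c i < m \<and> c i \<noteq> c (par 0 1 ts i) \<and> (kids 0 1 ts i = {} \<longrightarrow> c i = a))" for c a
    using map_in_colourings[of 0 1 c ts m a] by (simp add: n_def)
  have "bij_betw ?h P K"
    unfolding bij_betw_def
  proof (intro conjI subset_antisym subsetI)
    show "inj_on ?h P"
    proof (rule inj_onI)
      fix c d assume cd: "c \<in> P" "d \<in> P" "?h c = ?h d"
      show "c = d"
      proof (rule PiE_ext)
        show "c \<in> {0..<1 + n} \<rightarrow>\<^sub>E {..<m}" "d \<in> {0..<1 + n} \<rightarrow>\<^sub>E {..<m}" using cd by (auto simp: P_def)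
        fix i assume "i \<in> {0..<1 + n}"
        then show "c i = d i" using cd(3) by (cases "i = 0") (auto simp: map_eq_conv simp del: upt_Suc)
      qed
    qed
  next
    fix k assume "k \<in> ?h ` P"
    then obtain c where c: "c \<in> P" "k = ?h c" by blast
    have "c i < m" if "i \<in> {0..<1 + n}" for i
      using c(1) that by (auto simp: P_def PiE_iff)
    moreover have "c i = c n" if "i \<in> {1..<1 + n}" "kids 0 1 ts i = {}" for i
      using c(1) that \<open>n \<in> S\<close> by (auto simp: P_def constant_on_set_def S_def)
    ultimately have "map c [1..<1 + n] \<in> colourings m (c n) (c 0) ts"
      unfolding mem using c(1) by (auto simp: P_def)
    then show "k \<in> K"
      using c \<open>\<And>i. i \<in> {0..<1 + n} \<Longrightarrow> c i < m\<close> by (auto simp: K_def simp del: upt_Suc)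
  next
    fix k assume "k \<in> K"
    then obtain a \<gamma> xs where k: "k = (a, \<gamma>, xs)" "a < m" "\<gamma> < m" "xs \<in> colourings m a \<gamma> ts"
      by (auto simp: K_def)
    have len: "length xs = n" using colourings_length[OF k(4)] by (simp add: n_def)
    define c where "c = (\<lambda>i\<in>{0..<1 + n}. (\<gamma> # xs) ! i)"
    have map: "map c [1..<1 + n] = xs"
      using len by (intro nth_equalityI) (auto simp: c_def simp del: upt_Suc)
    have c0: "c 0 = \<gamma>" by (simp add: c_def)
    have proper: "\<forall>i\<in>{1..<1 + n}. c i < m \<and> c i \<noteq> c (par 0 1 ts i) \<and> (kids 0 1 ts i = {} \<longrightarrow> c i = a)"
      using k(4) mem[of c a] unfolding map c0 by blast
    have "c i < m" if "i \<in> {0..<1 + n}" for i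
      using proper c0 k(3) that by (cases "i = 0") auto
    then have "c \<in> P"
      using proper by (auto simp: P_def S_def constant_on_set_def c_def)
    moreover have "c n = a" using proper \<open>n \<in> S\<close> by (auto simp: S_def)
    ultimately show "k \<in> ?h ` P" using k(1) map c0 by (auto simp: image_iff simp del: upt_Suc)
  qed
  then have card: "card P = card K" by (rule bij_betw_same_card)
  have "card K = (\<Sum>a<m. \<Sum>\<gamma><m. card (colourings m a \<gamma> ts))"
    unfolding K_def by (subst card_SigmaI, (auto simp: finite_colourings intro!: finite_SigmaI)[2])
      (intro sum.cong refl, subst card_SigmaI, auto simp: finite_colourings)
  then have "of_nat (card K) = (\<Sum>a<m. \<Sum>\<gamma><m. if \<gamma> = a then same_wt ts (of_nat m - 1) else diff_wt ts (of_nat m - 1))"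
    by (simp add: card_colourings)
  also have "\<dots> = (\<Sum>a<m. same_wt ts (of_nat m - 1) + (of_nat m - 1) * diff_wt ts (of_nat m - 1))"
  proof (rule sum.cong[OF refl])
    fix a assume a: "a \<in> {..<m}"
    then have "{..<m} = insert a ({..<m} - {a})" by auto
    then have "(\<Sum>\<gamma><m. if \<gamma> = a then same_wt ts (of_nat m - 1) else diff_wt ts (of_nat m - 1))
      = same_wt ts (of_nat m - 1) + (\<Sum>\<gamma>\<in>{..<m} - {a}. diff_wt ts (of_nat m - 1))"
      using a by (subst sum.remove[of _ a]) (auto intro!: sum.cong)
    then show "(\<Sum>\<gamma><m. if \<gamma> = a then same_wt ts (of_nat m - 1) else diff_wt ts (of_nat m - 1))
      = same_wt ts (of_nat m - 1) + (of_nat m - 1) * diff_wt ts (of_nat m - 1)"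
      using a by (simp add: of_nat_diff)
  qed
  finally have cardK: "of_nat (card K) =
      of_nat m * same_wt ts (of_nat m - 1) + of_nat m * (of_nat m - 1) * diff_wt ts (of_nat m - 1)"
    by (simp add: algebra_simps)
  have "chromatic_poly (leaf_joined_tree (tree_graph ts) 0) (of_nat m) = of_nat (card P)"
  proof -
    have "S \<subseteq> vertices (tree_graph ts)" by (auto simp: S_def n_def)
    from chromatic_poly_identify[OF finite_multigraph_tree_graph this, of m] show ?thesis
      unfolding leaf_joined_tree_def leaves_tree_graph
      by (simp only: tree_graph_simps const P_def S_def n_def)
  qed
  then show ?thesis using card cardK by simp
qed

lemma poly_eq_of_nat_imp_eq:
  fixes p r :: "complex poly"
  assumes "\<And>m. poly p (of_nat m) = poly r (of_nat m)"
  shows "p = r"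
proof (rule ccontr)
  assume "p \<noteq> r"
  then have "finite {x. poly (p - r) x = 0}" by (intro poly_roots_finite) simp
  moreover have "range of_nat \<subseteq> {x. poly (p - r) x = 0}" using assms by auto
  ultimately have "finite (range (of_nat :: nat \<Rightarrow> complex))" by (rule finite_subset[rotated])
  then show False by (simp add: finite_image_iff inj_of_nat)
qed

lemma wt_polynomial:
  "(\<exists>p. \<forall>x. same_wt ts x = poly p x) \<and> (\<exists>p. \<forall>x. diff_wt ts x = poly p x)"
proof (induction ts rule: fsize.induct)
  case 1
  show ?case by (auto intro!: exI[of _ 1])
next
  case (2 cs ts)
  then obtain p r p' r' where
    IH: "\<And>x. same_wt cs x = poly p x" "\<And>x. diff_wt cs x = poly r x"
        "\<And>x. same_wt ts x = poly p' x" "\<And>x. diff_wt ts x = poly r' x" by blast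
  have "same_wt (Node cs # ts) x = poly ((if cs = [] then 0 else [:0, 1:] * r) * p') x"
    "diff_wt (Node cs # ts) x = poly ((if cs = [] then 1 else p + [:-1, 1:] * r) * r') x" for x
    by (auto simp: IH algebra_simps)
  then show ?case by blast
qed

text \<open>
  Both sides are polynomials in \<open>q\<close> that agree at all natural numbers.
\<close>

theorem chromatic_poly_leaf_joined_tree:
  assumes "ts \<noteq> []"
  shows "chromatic_poly (leaf_joined_tree (tree_graph ts) 0) q =
    q * same_wt ts (q - 1) + q * (q - 1) * diff_wt ts (q - 1)"
proof -
  let ?G = "leaf_joined_tree (tree_graph ts) 0"
  obtain p r where pr: "\<And>x. same_wt ts x = poly p x" "\<And>x. diff_wt ts x = poly r x"
    using wt_polynomial[of ts] by blast
  define f where "f = (\<Sum>F\<in>Pow (edges ?G). monom ((-1) ^ card F) (card (conn_components (?G\<lparr>edges := F\<rparr>))) :: complex poly)"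
  define g where "g = [:0, 1:] * (p \<circ>\<^sub>p [:-1, 1:]) + [:0, 1:] * [:-1, 1:] * (r \<circ>\<^sub>p [:-1, 1:])"
  have f: "poly f x = chromatic_poly ?G x" for x
    by (simp add: f_def chromatic_poly_def poly_sum poly_monom)
  have g: "poly g x = x * same_wt ts (x - 1) + x * (x - 1) * diff_wt ts (x - 1)" for x
    by (simp add: g_def pr poly_pcompose algebra_simps)
  have "f = g"
    using chromatic_poly_leaf_joined_tree_nat[OF assms]
    by (intro poly_eq_of_nat_imp_eq) (simp add: f g)
  then show ?thesis using f[of q] g[of q] by simp
qed

section \<open>Ball arithmetic for the complex exponential\<close>

text \<open>
  The parameter is close to 1, so that the fixed point 0 attracts only weakly, and close to the boundary
  of the disc \<open>Re (1 / \<mu>) \<ge> 1\<close>, but with a small neighbourhood inside it.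
\<close>

definition mu0 :: complex where "mu0 = Complex (39 / 40) (- 39 / 250)"

lemma norm_mu0: "norm mu0 \<le> 1"
  by (simp add: mu0_def cmod_def power2_eq_square)

text \<open>
  A triple \<open>(p, q, w)\<close> stands for the disc with centre \<open>(p + i q) / 2 ^ 32\<close> and radius \<open>w / 2 ^ 32\<close>. With a power
  of two as scale, rounding after a multiplication is a shift.
\<close>

type_synonym ball = "int \<times> int \<times> int"

fun in_ball :: "complex \<Rightarrow> ball \<Rightarrow> bool" where
  "in_ball z (p, q, w) \<longleftrightarrow> norm (2 ^ 32 * z - Complex (of_int p) (of_int q)) \<le> of_int w"

fun ball_mult :: "ball \<Rightarrow> ball \<Rightarrow> ball" where
  "ball_mult (p, q, w) (p', q', w') =
     (drop_bit 32 (p * p' - q * q'), drop_bit 32 (p * q' + q * p'),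
      drop_bit 32 ((\<bar>p\<bar> + \<bar>q\<bar>) * w' + (\<bar>p'\<bar> + \<bar>q'\<bar>) * w + w * w') + 3)"

fun ball_add :: "ball \<Rightarrow> int \<Rightarrow> ball" where
  "ball_add (p, q, w) c = (p + c, q, w + 1)"

definition ball_square :: "ball \<Rightarrow> ball" where
  "ball_square b = ball_mult b b"

text \<open>
  Given a ball for \<open>z\<close> with \<open>norm z \<le> 1\<close>, this computes one for \<open>exp (8 z)\<close>: Horner's scheme for the exponential
  series of \<open>z\<close>, then three squarings. The integers are the rounded values of \<open>2 ^ 32 / k!\<close>, and the
  initial ball, of radius at least \<open>3 * 2 ^ 32 / 8!\<close>, absorbs the tail of the series.
\<close>

definition exp_ball :: "ball \<Rightarrow> ball" where
  "exp_ball b = ball_square (ball_square (ball_square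
     (foldl (\<lambda>acc c. ball_add (ball_mult b acc) c) (106522, 0, 319575)
        [852176, 5965232, 35791394, 178956971, 715827883, 2147483648, 4294967296, 4294967296])))"

text \<open>
  An upper bound for the modulus, \<open>max + min / 2\<close> of the coordinates. Using the sum of the coordinates
  instead would accumulate too large an error over the whole chain.
\<close>

fun abs_bound :: "ball \<Rightarrow> int" where
  "abs_bound (p, q, w) = max \<bar>p\<bar> \<bar>q\<bar> + drop_bit 1 (min \<bar>p\<bar> \<bar>q\<bar>) + 1 + w"

fun inflate :: "ball \<Rightarrow> int \<Rightarrow> ball" where
  "inflate (p, q, w) e = (p, q, w + e)"

fun one_minus :: "ball \<Rightarrow> ball" where
  "one_minus (p, q, w) = (4294967296 - p, - q, w)"

text \<open>
  For two exponents at distance \<open>h \<le> 1\<close> the exponentials differ by at most \<open>norm (exp b) (h + 3 h\<^sup>2)\<close>.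
\<close>

fun spread :: "int \<Rightarrow> int \<Rightarrow> int" where
  "spread m e = drop_bit 32 (m * (e + drop_bit 32 (3 * e * e) + 1)) + 2"

text \<open>
  One step of the chain sends \<open>z\<close> to \<open>\<mu>\<^sub>0 (1 - exp ((1 - t / 10) z + t / 10 \<mu>\<^sub>0))\<close>. This is an eighth of the
  exponent for the centre of the ball. The integers 4187593114 and -670014898 are the coordinates of \<open>\<mu>\<^sub>0\<close>
  at scale \<open>2 ^ 32\<close>; the radius of the ball enters only through \<open>spread\<close>, since a direct
  evaluation would replace the factor \<open>norm (exp b)\<close> by the much larger \<open>exp (norm b)\<close>.
\<close>

fun chain_arg :: "int \<Rightarrow> ball \<Rightarrow> ball" where
  "chain_arg t (x, y, e) = (((10 - t) * x + t * 4187593114) div 80, ((10 - t) * y + t * (- 670014898)) div 80, 3)"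

fun chain_step :: "ball \<Rightarrow> int \<Rightarrow> ball" where
  "chain_step E e = inflate (ball_mult (4187593114, - 670014898, 1) (one_minus E)) (spread (abs_bound E) (e + 2))"

fun small_ball :: "ball \<Rightarrow> bool" where
  "small_ball (p, q, w) \<longleftrightarrow> \<bar>p\<bar> + \<bar>q\<bar> + w \<le> 4294967296"

fun chain :: "int list \<Rightarrow> ball \<Rightarrow> ball option" where
  "chain [] s = Some s"
| "chain (t # ts) (x, y, e) =
     (if small_ball (chain_arg t (x, y, e)) \<and> e + 2 \<le> 4294967296
      then chain ts (chain_step (exp_ball (chain_arg t (x, y, e))) e) else None)"

lemma drop_bit_real:
  "\<bar>of_int a / 2 ^ n - of_int (drop_bit n a)\<bar> \<le> (1::real)"
  "of_int a / 2 ^ n \<le> of_int (drop_bit n a) + (1::real)"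
proof -
  have "of_int (drop_bit n a) = (of_int \<lfloor>of_int a / 2 ^ n :: real\<rfloor> :: real)"
    using floor_divide_of_int_eq[where 'a = real, of a "2 ^ n"] by (simp add: drop_bit_eq_div)
  then show "\<bar>of_int a / 2 ^ n - of_int (drop_bit n a)\<bar> \<le> (1::real)"
    "of_int a / 2 ^ n \<le> of_int (drop_bit n a) + (1::real)"
    using floor_correct[of "of_int a / 2 ^ n :: real"] by linarith+
qed

lemma norm_Complex_le: "norm (Complex a b) \<le> \<bar>a\<bar> + \<bar>b\<bar>"
  using cmod_le[of "Complex a b"] by simp

lemma in_ball_mult:
  assumes "in_ball z B" "in_ball z' B'"
  shows "in_ball (z * z') (ball_mult B B')"
proof -
  obtain p q w p' q' w' where B: "B = (p, q, w)" "B' = (p', q', w')"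
    using prod_cases3 by metis
  define P where "P = Complex (of_int p) (of_int q)"
  define P' where "P' = Complex (of_int p') (of_int q')"
  define d where "d = 2 ^ 32 * z - P"
  define d' where "d' = 2 ^ 32 * z' - P'"
  have d: "norm d \<le> of_int w" and d': "norm d' \<le> of_int w'"
    using assms by (simp_all add: B P_def P'_def d_def d'_def)
  have w: "0 \<le> real_of_int w" "0 \<le> real_of_int w'"
    using d d' norm_ge_zero order_trans by blast+
  have P: "norm P \<le> of_int (\<bar>p\<bar> + \<bar>q\<bar>)" and P': "norm P' \<le> of_int (\<bar>p'\<bar> + \<bar>q'\<bar>)"
    using norm_Complex_le[of "of_int p" "of_int q"] norm_Complex_le[of "of_int p'" "of_int q'"]
    by (simp_all add: P_def P'_def)
  define e where "e = (\<bar>p\<bar> + \<bar>q\<bar>) * w' + (\<bar>p'\<bar> + \<bar>q'\<bar>) * w + w * w'"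
  have "norm (P * d' + P' * d + d * d') \<le> norm P * norm d' + norm P' * norm d + norm d * norm d'"
    by (metis (no_types, lifting) add_mono norm_mult norm_triangle_ineq norm_triangle_mono order_refl)
  also have "\<dots> \<le> of_int (\<bar>p\<bar> + \<bar>q\<bar>) * of_int w' + of_int (\<bar>p'\<bar> + \<bar>q'\<bar>) * of_int w + of_int w * of_int w'"
    using P P' d d' w by (intro add_mono mult_mono) auto
  also have "\<dots> = of_int e" by (simp add: e_def)
  finally have err: "norm (P * d' + P' * d + d * d') / 2 ^ 32 \<le> of_int e / 2 ^ 32"
    by (simp add: divide_right_mono)
  define a where "a = p * p' - q * q'"
  define b where "b = p * q' + q * p'"
  have PP: "P * P' = Complex (of_int a) (of_int b)"
    by (simp add: P_def P'_def a_def b_def complex_eq_iff)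
  have "2 ^ 32 * (z * z') = (P + d) * (P' + d') / 2 ^ 32"
    by (simp add: d_def d'_def)
  also have "\<dots> = P * P' / 2 ^ 32 + (P * d' + P' * d + d * d') / 2 ^ 32"
    by (simp add: algebra_simps add_divide_distrib)
  finally have split: "2 ^ 32 * (z * z') - Complex (of_int (drop_bit 32 a)) (of_int (drop_bit 32 b))
      = (P * P' / 2 ^ 32 - Complex (of_int (drop_bit 32 a)) (of_int (drop_bit 32 b)))
        + (P * d' + P' * d + d * d') / 2 ^ 32" by simp
  have "P * P' / 2 ^ 32 - Complex (of_int (drop_bit 32 a)) (of_int (drop_bit 32 b))
      = Complex (of_int a / 2 ^ 32 - of_int (drop_bit 32 a)) (of_int b / 2 ^ 32 - of_int (drop_bit 32 b))"
    unfolding PP by (simp add: complex_eq_iff)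
  also have "norm \<dots> \<le> 1 + 1"
    by (intro order_trans[OF norm_Complex_le] add_mono drop_bit_real)
  finally have rnd: "norm (P * P' / 2 ^ 32 - Complex (of_int (drop_bit 32 a)) (of_int (drop_bit 32 b))) \<le> 2" by simp
  have "norm (2 ^ 32 * (z * z') - Complex (of_int (drop_bit 32 a)) (of_int (drop_bit 32 b)))
      \<le> 2 + of_int e / 2 ^ 32"
    unfolding split using err rnd
    by (intro order_trans[OF norm_triangle_ineq] add_mono) (simp_all only: norm_divide norm_power norm_numeral)
  also have "\<dots> \<le> of_int (drop_bit 32 e + 3)"
    using drop_bit_real(2)[of e 32] by simp
  finally show ?thesis unfolding B by (simp add: a_def b_def e_def)
qed

lemma in_ball_square: "in_ball z B \<Longrightarrow> in_ball (z ^ 2) (ball_square B)"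
  unfolding ball_square_def power2_eq_square by (rule in_ball_mult)

lemma in_ball_add:
  assumes "in_ball z B" "\<bar>2 ^ 32 * c - of_int k\<bar> \<le> 1"
  shows "in_ball (complex_of_real c + z) (ball_add B k)"
proof -
  obtain p q w where B: "B = (p, q, w)" using prod_cases3 by metis
  have "2 ^ 32 * (complex_of_real c + z) - Complex (of_int (p + k)) (of_int q)
      = (2 ^ 32 * z - Complex (of_int p) (of_int q)) + complex_of_real (2 ^ 32 * c - of_int k)"
    by (simp add: complex_eq_iff algebra_simps)
  also have "norm \<dots> \<le> of_int w + 1"
    using assms unfolding B by (intro order_trans[OF norm_triangle_ineq] add_mono) (auto simp del: of_real_diff)
  finally show ?thesis by (simp add: B)
qed

lemma exp_Horner:
  fixes z :: complex
  assumes "norm z \<le> 1"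
  obtains r where "norm (r - 1 / 40320) \<le> 3 / 40320"
    "exp z = 1 + z * (1 + z * (1/2 + z * (1/6 + z * (1/24 + z * (1/120 + z * (1/720 + z * (1/5040 + z * r)))))))"
proof (cases "z = 0")
  case True
  then show ?thesis by (intro that[of "1 / 40320"]) auto
next
  case False
  define p where "p = (\<Sum>k\<le>7. z ^ k / fact k)"
  define r where "r = (exp z - p) / z ^ 8"
  have "norm (exp z - (p + z ^ 8 / fact 8)) \<le> exp \<bar>Re z\<bar> * norm z ^ 9 / fact 8"
    using Taylor_exp[of z 8] by (simp add: p_def numeral_eq_Suc)
  also have "\<dots> \<le> 3 * norm z ^ 8 / fact 8"
  proof -
    have "exp \<bar>Re z\<bar> \<le> exp 1" using assms abs_Re_le_cmod[of z] by simp
    also have "\<dots> \<le> 3" by (rule exp_le)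
    finally have "exp \<bar>Re z\<bar> \<le> 3" .
    moreover have "norm z ^ 9 \<le> norm z ^ 8" using assms by (intro power_decreasing) auto
    ultimately show ?thesis by (intro divide_right_mono mult_mono) auto
  qed
  finally have *: "norm (exp z - (p + z ^ 8 / fact 8)) \<le> 3 * norm z ^ 8 / fact 8" .
  have "r - 1 / 40320 = (exp z - (p + z ^ 8 / fact 8)) / z ^ 8"
    using False by (simp add: r_def diff_divide_distrib add_divide_distrib fact_numeral)
  then have "norm (r - 1 / 40320) = norm (exp z - (p + z ^ 8 / fact 8)) / norm z ^ 8"
    by (simp only: norm_divide norm_power)
  also have "\<dots> \<le> (3 * norm z ^ 8 / fact 8) / norm z ^ 8"
    using * by (intro divide_right_mono) auto
  also have "\<dots> = 3 / 40320" using False by (simp add: fact_numeral)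
  finally have "norm (r - 1 / 40320) \<le> 3 / 40320" .
  moreover have "exp z = 1 + z * (1 + z * (1/2 + z * (1/6 + z * (1/24 + z * (1/120 + z * (1/720 + z * (1/5040 + z * r)))))))"
  proof -
    have "exp z = p + z ^ 8 * r" using False by (simp add: r_def)
    also have "p = 1 + z + z^2/2 + z^3/6 + z^4/24 + z^5/120 + z^6/720 + z^7/5040"
      by (simp add: p_def numeral_eq_Suc fact_Suc)
    finally show ?thesis by (simp add: distrib_left power_numeral_reduce mult.assoc flip: add.assoc)
  qed
  ultimately show ?thesis by (rule that)
qed

lemma in_exp_ball:
  assumes "in_ball z B" "small_ball B"
  shows "in_ball (exp (8 * z)) (exp_ball B)"
proof -
  obtain p q w where B: "B = (p, q, w)" using prod_cases3 by metis
  have "2 ^ 32 * norm z = norm (2 ^ 32 * z)" by (simp add: norm_mult norm_power)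
  also have "\<dots> \<le> norm (2 ^ 32 * z - Complex (of_int p) (of_int q)) + norm (Complex (of_int p) (of_int q))"
    using norm_triangle_sub by (metis add.commute)
  also have "\<dots> \<le> of_int (\<bar>p\<bar> + \<bar>q\<bar> + w)"
    using assms(1) norm_Complex_le[of "of_int p" "of_int q"] by (simp add: B)
  also have "\<dots> \<le> of_int 4294967296" using assms(2) unfolding B small_ball.simps of_int_le_iff .
  finally have "norm z \<le> 1" by simp
  from exp_Horner[OF this] obtain r where r: "norm (r - 1 / 40320) \<le> 3 / 40320"
    "exp z = 1 + z * (1 + z * (1/2 + z * (1/6 + z * (1/24 + z * (1/120 + z * (1/720 + z * (1/5040 + z * r)))))))"
    by blast
  \<comment> \<open>The tail differs from its first term by at most three times that term.\<close>
  have "in_ball r (106522, 0, 319575)"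
  proof -
    have "2 ^ 32 * r - Complex (of_int 106522) (of_int 0)
        = 2 ^ 32 * (r - 1 / 40320) + complex_of_real (2 ^ 32 / 40320 - 106522)"
      by (simp add: complex_eq_iff algebra_simps)
    also have "norm \<dots> \<le> 2 ^ 32 * (3 / 40320) + 1"
      using r(1) by (intro order_trans[OF norm_triangle_ineq] add_mono)
        (simp_all only: norm_mult norm_power norm_of_real norm_numeral, simp_all)
    also have "\<dots> \<le> of_int 319575" by simp
    finally show ?thesis by simp
  qed
  then have "in_ball (of_real 1 + z * (of_real 1 + z * (of_real (1/2) + z * (of_real (1/6) + z * (of_real (1/24)
        + z * (of_real (1/120) + z * (of_real (1/720) + z * (of_real (1/5040) + z * r))))))))
      (foldl (\<lambda>acc c. ball_add (ball_mult B acc) c) (106522, 0, 319575)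
        [852176, 5965232, 35791394, 178956971, 715827883, 2147483648, 4294967296, 4294967296])"
    unfolding foldl.simps by (intro in_ball_add in_ball_mult assms(1)) simp_all
  then have "in_ball (exp z) (foldl (\<lambda>acc c. ball_add (ball_mult B acc) c) (106522, 0, 319575)
        [852176, 5965232, 35791394, 178956971, 715827883, 2147483648, 4294967296, 4294967296])"
    unfolding r(2) by (simp del: foldl.simps)
  moreover have "exp (8 * z) = ((exp z ^ 2) ^ 2) ^ 2"
    by (simp add: exp_of_nat_mult[of 8, simplified] flip: power_mult)
  ultimately show ?thesis unfolding exp_ball_def by (metis in_ball_square)
qed

lemma norm_le_abs_bound:
  assumes "in_ball z B"
  shows "2 ^ 32 * norm z \<le> of_int (abs_bound B)"
proof -
  obtain p q w where B: "B = (p, q, w)" using prod_cases3 by metis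
  define a where "a = max \<bar>p\<bar> \<bar>q\<bar>"
  define b where "b = min \<bar>p\<bar> \<bar>q\<bar>"
  have ab: "0 \<le> b" "b \<le> a" "p\<^sup>2 + q\<^sup>2 = a\<^sup>2 + b\<^sup>2"
    by (auto simp: a_def b_def max_def min_def)
  have "real_of_int (p\<^sup>2 + q\<^sup>2) = real_of_int (a\<^sup>2 + b\<^sup>2)" using ab(3) by (rule arg_cong)
  also have "\<dots> \<le> (of_int a + of_int b / 2)\<^sup>2"
  proof -
    have "real_of_int b * real_of_int b \<le> real_of_int a * real_of_int b"
      using ab by (intro mult_right_mono) auto
    moreover have "(of_int a + of_int b / 2)\<^sup>2 = real_of_int a ^ 2 + real_of_int a * real_of_int b + real_of_int b * real_of_int b / 4"
      by (simp add: power2_eq_square field_simps)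
    moreover have "real_of_int (a\<^sup>2 + b\<^sup>2) = real_of_int a ^ 2 + real_of_int b * real_of_int b"
      by (simp add: power2_eq_square)
    ultimately show ?thesis using zero_le_square[of "real_of_int b"] by linarith
  qed
  finally have sq: "(real_of_int p)\<^sup>2 + (real_of_int q)\<^sup>2 \<le> (of_int a + of_int b / 2)\<^sup>2"
    by (simp only: of_int_add of_int_power)
  have "norm (Complex (of_int p) (of_int q)) \<le> of_int a + of_int b / 2"
    using sq ab by (auto simp: cmod_def intro!: real_le_lsqrt)
  also have "\<dots> \<le> of_int (a + drop_bit 1 b + 1)"
    using drop_bit_real(2)[of b 1] by simp
  finally have "norm (Complex (of_int p) (of_int q)) \<le> of_int (a + drop_bit 1 b + 1)" .
  moreover have "2 ^ 32 * norm z \<le> norm (2 ^ 32 * z - Complex (of_int p) (of_int q)) + norm (Complex (of_int p) (of_int q))"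
    using norm_triangle_sub[of "2 ^ 32 * z" "Complex (of_int p) (of_int q)"] by (simp add: norm_mult norm_power)
  ultimately show ?thesis using assms by (simp add: B a_def b_def)
qed

lemma norm_exp_minus_one: "norm z \<le> 1 \<Longrightarrow> norm (exp z - 1) \<le> norm z + 3 * norm z ^ 2" for z :: complex
proof -
  assume z: "norm z \<le> 1"
  have "norm (exp z - (1 + z)) \<le> exp \<bar>Re z\<bar> * norm z ^ 2"
    using Taylor_exp[of z 1] by (simp add: numeral_2_eq_2)
  also have "exp \<bar>Re z\<bar> \<le> exp 1" using z abs_Re_le_cmod[of z] by simp
  also have "exp 1 \<le> (3 :: real)" by (rule exp_le)
  finally have "norm (exp z - (1 + z)) \<le> 3 * norm z ^ 2" by (simp add: mult_right_mono)
  then show ?thesis using norm_triangle_ineq[of "exp z - (1 + z)" z] by (simp add: algebra_simps)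
qed

lemma in_ball_one_minus: "in_ball z B \<Longrightarrow> in_ball (1 - z) (one_minus B)"
proof -
  assume z: "in_ball z B"
  obtain p q w where B: "B = (p, q, w)" using prod_cases3 by metis
  have "2 ^ 32 * (1 - z) - Complex (of_int (4294967296 - p)) (of_int (- q)) = - (2 ^ 32 * z - Complex (of_int p) (of_int q))"
    by (simp add: complex_eq_iff)
  then show ?thesis using z unfolding B one_minus.simps in_ball.simps by (simp only: norm_minus_cancel)
qed

lemma in_ball_inflate:
  assumes "in_ball z B" "2 ^ 32 * norm (z' - z) \<le> of_int e"
  shows "in_ball z' (inflate B e)"
proof -
  obtain p q w where B: "B = (p, q, w)" using prod_cases3 by metis
  have "norm (2 ^ 32 * z' - Complex (of_int p) (of_int q))
      \<le> norm (2 ^ 32 * z - Complex (of_int p) (of_int q)) + norm (2 ^ 32 * (z' - z))"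
    by (rule order_trans[OF _ norm_triangle_ineq]) (simp add: algebra_simps)
  also have "norm (2 ^ 32 * (z' - z)) = 2 ^ 32 * norm (z' - z)" by (simp only: norm_mult norm_power norm_numeral)
  finally show ?thesis using assms by (simp add: B)
qed

lemma in_chain_arg:
  assumes "0 \<le> t" "t \<le> 10"
  shows "in_ball ((of_real (1 - of_int t / 10) * (Complex (of_int x) (of_int y) / 2 ^ 32)
                    + of_real (of_int t / 10) * mu0) / 8) (chain_arg t (x, y, e))"
proof -
  have lin: "2 ^ 32 * (((1 - \<tau> / 10) * (u / 2 ^ 32) + \<tau> / 10 * c) / 8) = ((10 - \<tau>) * u + \<tau> * k) / 80 + \<tau> * ((2 ^ 32 * c - k) / 80)"
    for \<tau> u c k :: real
    by (simp add: field_simps)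
  have coord: "\<bar>2 ^ 32 * (((1 - of_int t / 10) * (of_int u / 2 ^ 32) + of_int t / 10 * c) / 8) - of_int (((10 - t) * u + t * k) div 80)\<bar>
      \<le> 1 + 1 / 4" if "\<bar>2 ^ 32 * c - of_int k\<bar> \<le> 1" for u k :: int and c :: real
  proof -
    define M where "M = (10 - t) * u + t * k"
    have "\<bar>of_int M / 80 - of_int (M div 80)\<bar> \<le> (1 :: real)"
      using floor_correct[of "of_int M / 80 :: real"] floor_divide_of_int_eq[where 'a = real, of M 80]
      by (simp add: abs_le_iff)
    moreover have "\<bar>of_int t * ((2 ^ 32 * c - of_int k) / 80)\<bar> \<le> 10 * (1 / 80)"
      unfolding abs_mult by (intro mult_mono) (use assms that in auto)
    moreover have M: "((10 - of_int t) * of_int u + of_int t * of_int k :: real) = of_int M" by (simp add: M_def)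
    moreover have "\<bar>a + b - d\<bar> \<le> 1 + 1 / 4" if "\<bar>a - d\<bar> \<le> 1" "\<bar>b\<bar> \<le> 10 * (1 / 80)" for a b d :: real
      using that by linarith
    ultimately show ?thesis unfolding lin[of _ _ _ "of_int k"] M_def[symmetric] M by blast
  qed
  have "2 ^ 32 * ((of_real (1 - of_int t / 10) * (Complex (of_int x) (of_int y) / 2 ^ 32) + of_real (of_int t / 10) * mu0) / 8)
      = Complex (2 ^ 32 * (((1 - of_int t / 10) * (of_int x / 2 ^ 32) + of_int t / 10 * (39 / 40)) / 8))
          (2 ^ 32 * (((1 - of_int t / 10) * (of_int y / 2 ^ 32) + of_int t / 10 * (- 39 / 250)) / 8))"
    by (simp add: complex_eq_iff mu0_def)
  moreover have "norm (Complex (2 ^ 32 * (((1 - of_int t / 10) * (of_int x / 2 ^ 32) + of_int t / 10 * (39 / 40)) / 8))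
          (2 ^ 32 * (((1 - of_int t / 10) * (of_int y / 2 ^ 32) + of_int t / 10 * (- 39 / 250)) / 8))
      - Complex (of_int (((10 - t) * x + t * 4187593114) div 80)) (of_int (((10 - t) * y + t * (- 670014898)) div 80)))
      \<le> (1 + 1 / 4) + (1 + 1 / 4)"
    unfolding complex_diff by (intro order_trans[OF norm_Complex_le] add_mono coord) simp_all
  ultimately show ?thesis
    unfolding chain_arg.simps in_ball.simps by simp
qed

text \<open>
  The exponent may be off by \<open>1 / 2 ^ 32\<close>. This leaves room for the difference between the recursion at
  finite degree and its limit.
\<close>

lemma chain_step_sound:
  assumes z: "in_ball z (x, y, e)" and t: "0 \<le> t" "t \<le> 10"
    and small: "small_ball (chain_arg t (x, y, e))" "e + 2 \<le> 4294967296"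
    and a: "norm (a - (of_real (1 - of_int t / 10) * z + of_real (of_int t / 10) * mu0)) \<le> 1 / 2 ^ 32"
  shows "in_ball (mu0 * (1 - exp a)) (chain_step (exp_ball (chain_arg t (x, y, e))) e)"
proof -
  define c where "c = Complex (of_int x) (of_int y) / 2 ^ 32"
  define s where "s = 1 - of_int t / (10 :: real)"
  define T where "T = of_int t / (10 :: real)"
  define b where "b = of_real s * c + of_real T * mu0"
  have s: "\<bar>s\<bar> \<le> 1" using t by (simp add: s_def)
  define E where "E = exp_ball (chain_arg t (x, y, e))"
  have "in_ball (exp (8 * (b / 8))) E"
    using in_exp_ball[OF in_chain_arg[OF t, of x y e] small(1)] unfolding E_def b_def c_def s_def T_def .
  then have E: "in_ball (exp b) E" by simp
  have zc: "2 ^ 32 * norm (z - c) \<le> of_int e"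
  proof -
    have "2 ^ 32 * norm (z - c) = norm (2 ^ 32 * (z - c))" by (simp only: norm_mult norm_power norm_numeral)
    also have "2 ^ 32 * (z - c) = 2 ^ 32 * z - Complex (of_int x) (of_int y)" by (simp add: c_def algebra_simps)
    finally show ?thesis using z by simp
  qed
  have e0: "0 \<le> e" using order_trans[OF _ zc, of 0] by simp
  define h where "h = of_int (e + 2) / (2 ^ 32 :: real)"
  have h: "0 \<le> h" "h \<le> 1" using e0 small(2) by (simp_all add: h_def)
  have ab: "norm (a - b) \<le> h"
  proof -
    have "a - b = (a - (of_real s * z + of_real T * mu0)) + of_real s * (z - c)"
      by (simp add: b_def algebra_simps)
    also have "norm \<dots> \<le> 1 / 2 ^ 32 + 1 * norm (z - c)"
      unfolding s_def T_def
      by (intro order_trans[OF norm_triangle_ineq] add_mono a)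
        (unfold norm_mult norm_of_real, fold s_def, intro mult_right_mono s norm_ge_zero)
    also have "\<dots> \<le> h" using zc by (simp add: h_def field_simps)
    finally show ?thesis .
  qed
  have "exp a - exp b = exp b * (exp (a - b) - 1)" by (simp add: algebra_simps exp_diff)
  then have "norm (exp a - exp b) = norm (exp b) * norm (exp (a - b) - 1)" by (simp only: norm_mult)
  also have "\<dots> \<le> (of_int (abs_bound E) / 2 ^ 32) * (h + 3 * h ^ 2)"
  proof (intro mult_mono)
    show "norm (exp b) \<le> of_int (abs_bound E) / 2 ^ 32"
      using norm_le_abs_bound[OF E] by (simp add: field_simps)
    then show "0 \<le> of_int (abs_bound E) / (2 ^ 32 :: real)" using norm_ge_zero order_trans by blast
    have "norm (exp (a - b) - 1) \<le> norm (a - b) + 3 * norm (a - b) ^ 2"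
      using ab h by (intro norm_exp_minus_one) auto
    also have "\<dots> \<le> h + 3 * h ^ 2" using ab by (intro add_mono mult_left_mono power_mono) auto
    finally show "norm (exp (a - b) - 1) \<le> h + 3 * h ^ 2" .
  qed auto
  finally have diff: "norm (exp a - exp b) \<le> (of_int (abs_bound E) / 2 ^ 32) * (h + 3 * h ^ 2)" .
  have mE: "0 \<le> real_of_int (abs_bound E)" using norm_le_abs_bound[OF E] by (rule order_trans[rotated]) simp
  have "2 ^ 32 * norm (mu0 * (1 - exp a) - mu0 * (1 - exp b)) = 2 ^ 32 * (norm mu0 * norm (exp a - exp b))"
    by (simp add: norm_mult norm_minus_commute flip: right_diff_distrib)
  also have "\<dots> \<le> 2 ^ 32 * (1 * ((of_int (abs_bound E) / 2 ^ 32) * (h + 3 * h ^ 2)))"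
    by (intro mult_left_mono mult_mono norm_mu0 diff) auto
  also have "\<dots> = of_int (abs_bound E) * (of_int (e + 2) + of_int (3 * (e + 2) * (e + 2)) / 2 ^ 32) / 2 ^ 32"
    by (simp add: h_def power2_eq_square field_simps)
  also have "\<dots> \<le> of_int (abs_bound E) * of_int (e + 2 + drop_bit 32 (3 * (e + 2) * (e + 2)) + 1) / 2 ^ 32"
    using drop_bit_real(2)[of "3 * (e + 2) * (e + 2)" 32] mE
    by (intro divide_right_mono mult_left_mono) (simp_all only: of_int_add of_int_1, simp_all)
  also have "\<dots> \<le> of_int (spread (abs_bound E) (e + 2))"
    using drop_bit_real(2)[of "abs_bound E * (e + 2 + drop_bit 32 (3 * (e + 2) * (e + 2)) + 1)" 32] by simp
  finally have "2 ^ 32 * norm (mu0 * (1 - exp a) - mu0 * (1 - exp b)) \<le> of_int (spread (abs_bound E) (e + 2))" .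
  moreover have "in_ball mu0 (4187593114, - 670014898, 1)"
  proof -
    have "2 ^ 32 * mu0 - Complex (of_int 4187593114) (of_int (- 670014898)) = Complex (2 ^ 32 * 39 / 40 - 4187593114) (670014898 - 2 ^ 32 * 39 / 250)"
      by (simp add: complex_eq_iff mu0_def)
    also have "norm \<dots> \<le> of_int 1" by (rule order_trans[OF norm_Complex_le]) simp
    finally show ?thesis by simp
  qed
  ultimately show ?thesis
    unfolding E_def[symmetric] chain_step.simps by (intro in_ball_inflate[OF in_ball_mult[OF _ in_ball_one_minus[OF E]]])
qed

lemma chain_sound:
  assumes "chain ts B = Some B'" "set ts \<subseteq> {0..10}" "R B"
    and "\<And>t x y e. 0 \<le> t \<Longrightarrow> t \<le> 10 \<Longrightarrow> R (x, y, e) \<Longrightarrow> small_ball (chain_arg t (x, y, e)) \<Longrightarrow> e + 2 \<le> 4294967296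
           \<Longrightarrow> R (chain_step (exp_ball (chain_arg t (x, y, e))) e)"
  shows "R B'"
  using assms(1-3)
proof (induction ts B rule: chain.induct)
  case (2 t ts x y e)
  then show ?case using assms(4) by (auto split: if_splits simp del: small_ball.simps chain_arg.simps chain_step.simps)
qed simp

text \<open>
  The entries are the shares, in tenths, that the initial defect gets among the children. For twelve steps
  the orbit evolves freely; it then needs repeated small pushes, and the last entry only turns
  the final value into the sector used later.
\<close>

lemma escape_chain:
  "chain [0, 0, 0, 0, 0, 0, 0, 0, 0, 0, 0, 0, 2, 0, 2, 0, 2, 0, 2, 0, 2, 0, 1, 0, 1, 0, 1, 0, 3] (4187593114, - 670014898, 1)
    = Some (484158253166, 959779535902, 9740339240)"
  by (simp add: exp_ball_def ball_square_def)

section \<open>Growing forests and the recursion for defects\<close>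

definition star :: "nat \<Rightarrow> rtree list" where
  "star n = replicate (n - 1) (Node [])"

text \<open>
  Starting from stars with \<open>n - 1\<close> leaves, and not from smaller ones, forces the maximum degree of the tree to be
  exactly \<open>n\<close>. It does not affect the weights, because any positive number of leaves below a vertex prevents
  it from having their colour.
\<close>

inductive grown :: "nat \<Rightarrow> rtree list \<Rightarrow> bool" for n where
  star: "grown n (star n)"
| node: "us \<noteq> [] \<Longrightarrow> length us < n \<Longrightarrow> \<forall>u\<in>set us. grown n u \<Longrightarrow> grown n (map Node us)"

lemma grown_nonempty: "grown n u \<Longrightarrow> 2 \<le> n \<Longrightarrow> u \<noteq> []"
  by (cases rule: grown.cases) (auto simp: star_def)

lemma outdegs_map_Node: "outdegs (map Node us) = (\<Union>u\<in>set us. insert (length u) (outdegs u))"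
  by (induction us) auto

lemma outdegs_replicate_leaf: "outdegs (replicate k (Node [])) \<subseteq> {0}"
  by (induction k) auto

lemma grown_degrees:
  assumes "grown n u" "2 \<le> n"
  shows "insert (length u) (outdegs u) \<subseteq> {..n - 1} \<and> n - 1 \<in> insert (length u) (outdegs u)"
  using assms
proof (induction rule: grown.induct)
  case star
  then show ?case using outdegs_replicate_leaf[of "n - 1"] by (auto simp: star_def)
next
  case (node us)
  then show ?case unfolding outdegs_map_Node by (cases us) auto
qed

lemma max_degree_grown:
  assumes "us \<noteq> []" "length us \<le> n" "2 \<le> n" "\<forall>u\<in>set us. grown n u"
  shows "max_degree (tree_graph (map Node us)) = n"
  unfolding max_degree_tree_graph
proof (rule Max_eqI)
  have sub: "outdegs (map Node us) \<subseteq> {..n - 1}" "n - 1 \<in> outdegs (map Node us)"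
    using grown_degrees[of n] assms unfolding outdegs_map_Node by (auto, (cases us; auto))
  then show "finite (insert (length (map Node us)) (Suc ` outdegs (map Node us)))"
    using finite_subset by auto
  show "y \<le> n" if "y \<in> insert (length (map Node us)) (Suc ` outdegs (map Node us))" for y
    using that sub(1) assms by auto
  have "n = Suc (n - 1)" using assms by simp
  then show "n \<in> insert (length (map Node us)) (Suc ` outdegs (map Node us))"
    using sub(2) by blast
qed

lemma wt_append:
  "same_wt (ts @ us) x = same_wt ts x * same_wt us x"
  "diff_wt (ts @ us) x = diff_wt ts x * diff_wt us x"
  by (induction ts rule: fsize.induct) auto

lemma wt_replicate_Node:
  assumes "u \<noteq> []"
  shows "same_wt (replicate k (Node u)) x = (x * diff_wt u x) ^ k"
    "diff_wt (replicate k (Node u)) x = (same_wt u x + (x - 1) * diff_wt u x) ^ k"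
  using assms by (induction k) auto

lemma wt_star:
  assumes "2 \<le> n"
  shows "same_wt (star n) x = 0" "diff_wt (star n) x = 1"
proof -
  obtain m where "n - 1 = Suc m" using assms by (cases "n - 1") auto
  moreover have "diff_wt (replicate k (Node [])) x = 1" for k by (induction k) auto
  ultimately show "same_wt (star n) x = 0" "diff_wt (star n) x = 1" by (simp_all add: star_def)
qed

text \<open>
  The deviation of the quotient of the weights from its trivial value 1, scaled so that the recursion
  has a limit for large \<open>n\<close>. Here \<open>q - 1 = n / \<mu>\<close>.
\<close>

definition defect :: "nat \<Rightarrow> rtree list \<Rightarrow> complex \<Rightarrow> complex" where
  "defect n u \<mu> = \<mu> * (1 - same_wt u (of_nat n / \<mu>) / diff_wt u (of_nat n / \<mu>))"

text \<open>
  If \<open>p\<close> does not have the prescribed colour, a child either has it or has one of the \<open>x - 1\<close> colours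
  different from both. In terms of the defect this weight is a perturbation of \<open>x * diff_wt u x\<close>, its counterpart
  if \<open>p\<close> has the prescribed colour.
\<close>

lemma child_weight:
  assumes "0 < n" "\<mu> \<noteq> 0" "diff_wt u (of_nat n / \<mu>) \<noteq> 0"
  shows "same_wt u (of_nat n / \<mu>) + (of_nat n / \<mu> - 1) * diff_wt u (of_nat n / \<mu>)
    = of_nat n / \<mu> * diff_wt u (of_nat n / \<mu>) * (1 - defect n u \<mu> / of_nat n)"
  using assms by (simp add: defect_def field_simps)

text \<open>
  The basic recursion: every child of defect \<open>z\<close> contributes the factor \<open>1 / (1 - z / n)\<close> to the quotient.
\<close>

lemma ratio_replicate_Node:
  assumes "0 < n" "\<mu> \<noteq> 0" "diff_wt u (of_nat n / \<mu>) \<noteq> 0" "defect n u \<mu> \<noteq> of_nat n" "u \<noteq> []"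
  shows "diff_wt (replicate k (Node u)) (of_nat n / \<mu>) \<noteq> 0"
    "same_wt (replicate k (Node u)) (of_nat n / \<mu>) / diff_wt (replicate k (Node u)) (of_nat n / \<mu>)
       = (1 / (1 - defect n u \<mu> / of_nat n)) ^ k"
proof -
  have nz: "1 - defect n u \<mu> / of_nat n \<noteq> 0" using assms by (simp add: field_simps)
  note w = wt_replicate_Node[OF assms(5)] child_weight[OF assms(1-3)]
  show "diff_wt (replicate k (Node u)) (of_nat n / \<mu>) \<noteq> 0"
    unfolding w using assms nz by simp
  show "same_wt (replicate k (Node u)) (of_nat n / \<mu>) / diff_wt (replicate k (Node u)) (of_nat n / \<mu>)
       = (1 / (1 - defect n u \<mu> / of_nat n)) ^ k"
    unfolding w using assms nz by (simp flip: power_divide)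
qed

definition reachable :: "nat \<Rightarrow> complex \<Rightarrow> bool" where
  "reachable n z \<longleftrightarrow> (\<exists>u. grown n u \<and> diff_wt u (of_nat n / mu0) \<noteq> 0 \<and> defect n u mu0 = z)"

lemma mu0_nonzero: "mu0 \<noteq> 0" by (simp add: mu0_def complex_eq_iff)

lemma reachable_mu0: "2 \<le> n \<Longrightarrow> reachable n mu0"
  unfolding reachable_def by (intro exI[of _ "star n"]) (simp add: grown.star wt_star defect_def)

lemma reachable_step:
  assumes "reachable n z" "2 \<le> n" "z \<noteq> of_nat n" "0 < k + l" "k + l < n"
  shows "reachable n (mu0 * (1 - (1 / (1 - z / of_nat n)) ^ k * (1 / (1 - mu0 / of_nat n)) ^ l))"
proof -
  obtain u where u: "grown n u" "diff_wt u (of_nat n / mu0) \<noteq> 0" "defect n u mu0 = z"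
    using assms(1) by (auto simp: reachable_def)
  define ts where "ts = replicate k (Node u) @ replicate l (Node (star n))"
  have ne: "u \<noteq> []" "star n \<noteq> []"
    using grown_nonempty[OF u(1)] grown_nonempty[OF grown.star] assms by auto
  have n0: "0 < n" using assms by simp
  have "norm mu0 < norm (of_nat n :: complex)"
    using norm_mu0 assms(2) by (simp del: of_nat_le_iff) 
  then have mun: "mu0 \<noteq> of_nat n" by (metis less_irrefl)
  have star: "diff_wt (star n) (of_nat n / mu0) \<noteq> 0" "defect n (star n) mu0 = mu0"
    using wt_star[OF assms(2)] by (simp_all add: defect_def)
  note R = ratio_replicate_Node[OF n0 mu0_nonzero u(2) _ ne(1), of k, unfolded u(3), OF assms(3)]
    ratio_replicate_Node[OF n0 mu0_nonzero star(1) _ ne(2), of l, unfolded star(2), OF mun]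
  have "ts = map Node (replicate k u @ replicate l (star n))" by (simp add: ts_def)
  moreover have "grown n (map Node (replicate k u @ replicate l (star n)))"
    using assms(4,5) u(1) by (intro grown.node) (auto intro: grown.star)
  moreover have "diff_wt ts (of_nat n / mu0) \<noteq> 0"
    using R(1,3) by (simp add: ts_def wt_append)
  moreover have "same_wt ts (of_nat n / mu0) / diff_wt ts (of_nat n / mu0)
      = (1 / (1 - z / of_nat n)) ^ k * (1 / (1 - mu0 / of_nat n)) ^ l"
    unfolding ts_def wt_append times_divide_times_eq[symmetric] R(2,4) by simp
  ultimately show ?thesis unfolding reachable_def defect_def by metis
qed

text \<open>
  From \<open>Ln (1 - w) = - w + O (w\<^sup>2)\<close>.
\<close>

lemma power_eq_exp:
  fixes z :: complex
  assumes "norm z \<le> of_nat n / 2" "0 < n"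
  obtains err where "(1 / (1 - z / of_nat n)) ^ k = exp (of_real (of_nat k / of_nat n) * z + err)"
    "norm err \<le> 2 * of_nat k * (norm z)\<^sup>2 / (of_nat n)\<^sup>2"
proof -
  define w where "w = z / of_nat n"
  have w: "norm w \<le> 1 / 2" using assms by (simp add: w_def norm_divide field_simps)
  then have nz: "1 - w \<noteq> 0" by auto
  define err where "err = - of_nat k * (Ln (1 + - w) - - w)"
  have "norm (Ln (1 + - w) - - w) \<le> norm (- w) ^ 2 / (1 - norm (- w))"
    using w by (intro Ln_approx_linear) simp
  also have "\<dots> \<le> norm w ^ 2 / (1 / 2)"
    using w by (intro frac_le) auto
  finally have "norm (Ln (1 + - w) - - w) \<le> 2 * norm w ^ 2" by simp
  then have "norm err \<le> of_nat k * (2 * norm w ^ 2)"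
    unfolding err_def norm_mult by (intro mult_mono) auto
  also have "\<dots> = 2 * of_nat k * (norm z)\<^sup>2 / (of_nat n)\<^sup>2"
    by (simp add: w_def norm_divide power_divide)
  finally have err: "norm err \<le> 2 * of_nat k * (norm z)\<^sup>2 / (of_nat n)\<^sup>2" .
  have "of_real (of_nat k / of_nat n) * z + err = of_nat k * (- Ln (1 - w))"
    by (simp add: err_def w_def algebra_simps)
  then have "exp (of_real (of_nat k / of_nat n) * z + err) = exp (- Ln (1 - w)) ^ k"
    by (simp only: exp_of_nat_mult)
  also have "\<dots> = (1 / (1 - z / of_nat n)) ^ k"
    using nz by (simp add: exp_minus w_def inverse_eq_divide)
  finally show ?thesis using err that by metis
qed

section \<open>Escape from the initial defect\<close>

definition eventually_reachable :: "ball \<Rightarrow> bool" where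
  "eventually_reachable B \<longleftrightarrow> (\<forall>\<^sub>F n in sequentially. \<exists>z. reachable n z \<and> in_ball z B)"

lemma in_ball_norm_le:
  assumes "in_ball z (x, y, e)"
  shows "norm z \<le> of_int (\<bar>x\<bar> + \<bar>y\<bar> + e)"
proof -
  have "norm z \<le> norm (2 ^ 32 * z)" by (simp only: norm_mult norm_power norm_numeral) simp
  also have "\<dots> \<le> norm (2 ^ 32 * z - Complex (of_int x) (of_int y)) + norm (Complex (of_int x) (of_int y))"
    using norm_triangle_sub by (metis add.commute)
  also have "\<dots> \<le> of_int (\<bar>x\<bar> + \<bar>y\<bar> + e)"
    using assms norm_Complex_le[of "of_int x" "of_int y"] by simp
  finally show ?thesis .
qed

text \<open>
  A vertex with \<open>n - 1\<close> children is split in the ratio \<open>10 - t : t\<close> between the given forest and the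
  star. All deviations from the limit recursion are of order \<open>1 / n\<close>, uniformly on the ball.
\<close>

lemma eventually_reachable_step:
  assumes t: "0 \<le> t" "t \<le> 10" and R: "eventually_reachable (x, y, e)"
    and small: "small_ball (chain_arg t (x, y, e))" "e + 2 \<le> 4294967296"
  shows "eventually_reachable (chain_step (exp_ball (chain_arg t (x, y, e))) e)"
proof -
  define M :: real where "M = of_int (\<bar>x\<bar> + \<bar>y\<bar> + e)"
  define s where "s = 1 - of_int t / (10 :: real)"
  have s: "0 \<le> s" "s \<le> 1" using t by (simp_all add: s_def)
  define K where "K = 2 * M + 2 * M\<^sup>2 + 5"
  have "\<forall>\<^sub>F n in sequentially. 2 * M + K * 4294967296 + 2 \<le> real n"
    by real_asymp
  then show ?thesis
    using R unfolding eventually_reachable_def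
  proof eventually_elim
    case (elim n)
    then obtain z where z: "reachable n z" "in_ball z (x, y, e)" by blast
    have zM: "norm z \<le> M" using in_ball_norm_le[OF z(2)] by (simp add: M_def)
    then have M0: "0 \<le> M" using norm_ge_zero order_trans by blast
    then have K: "5 \<le> K" by (simp add: K_def)
    have n2: "2 \<le> real n" using elim(1) M0 K by linarith
    have nM: "norm z \<le> real n / 2" "norm mu0 \<le> real n / 2"
      using elim(1) M0 K zM norm_mu0 n2 by linarith+
    have nK: "K / real n \<le> 1 / 2 ^ 32" using elim(1) M0 n2 by (simp add: field_simps)
    define k where "k = nat \<lfloor>s * (real n - 1)\<rfloor>"
    have nn: "0 \<le> s * (real n - 1)" "s * (real n - 1) \<le> real n - 1"
      using s n2 by (simp_all add: mult_left_le_one_le)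
    have k: "real k \<le> s * (real n - 1)" "s * (real n - 1) - 1 \<le> real k"
      using nn(1) unfolding k_def by linarith+
    have kn: "k < n" using k(1) nn(2) by linarith
    define l where "l = n - 1 - k"
    have l: "real l = real n - 1 - real k" using kn by (simp add: l_def of_nat_diff)
    have n0: "0 < n" "2 \<le> n" using n2 by auto
    have kl: "0 < k + l" "k + l < n" using kn n0 by (auto simp: l_def)
    obtain e1 where e1: "(1 / (1 - z / of_nat n)) ^ k = exp (of_real (of_nat k / of_nat n) * z + e1)"
      "norm e1 \<le> 2 * of_nat k * (norm z)\<^sup>2 / (of_nat n)\<^sup>2"
      using power_eq_exp[OF nM(1) n0(1)] by blast
    obtain e2 where e2: "(1 / (1 - mu0 / of_nat n)) ^ l = exp (of_real (of_nat l / of_nat n) * mu0 + e2)"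
      "norm e2 \<le> 2 * of_nat l * (norm mu0)\<^sup>2 / (of_nat n)\<^sup>2"
      using power_eq_exp[OF nM(2) n0(1)] by blast
    define a where "a = of_real (of_nat k / of_nat n) * z + e1 + (of_real (of_nat l / of_nat n) * mu0 + e2)"
    have errb: "2 * real j * b\<^sup>2 / (real n)\<^sup>2 \<le> 2 * c\<^sup>2 / real n" if "j \<le> n" "0 \<le> b" "b \<le> c" for j b c
    proof -
      have "2 * real j * b\<^sup>2 / (real n)\<^sup>2 \<le> 2 * real n * c\<^sup>2 / (real n)\<^sup>2"
        using that by (intro divide_right_mono mult_mono power_mono) auto
      also have "\<dots> = 2 * c\<^sup>2 / real n" using n0 by (simp add: power2_eq_square)
      finally show ?thesis .
    qed
    have "norm e1 \<le> 2 * M\<^sup>2 / real n"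
      using order_trans[OF e1(2) errb[of k "norm z" M]] kn zM by simp
    moreover have "norm e2 \<le> 2 * 1\<^sup>2 / real n"
      using order_trans[OF e2(2) errb[of l "norm mu0" 1]] norm_mu0 by (simp add: l_def)
    moreover have "norm (of_real (real k / real n - s) * z) \<le> 2 / real n * M"
      unfolding norm_mult norm_of_real
    proof (rule mult_mono)
      have "\<bar>real k - s * real n\<bar> \<le> 2"
        using k s by (simp add: algebra_simps abs_le_iff) 
      then show "\<bar>real k / real n - s\<bar> \<le> 2 / real n"
        using n0 by (simp add: field_simps abs_le_iff)
    qed (use zM M0 in auto)
    moreover have "norm (of_real (real l / real n - (1 - s)) * mu0) \<le> 3 / real n * 1"
      unfolding norm_mult norm_of_real
    proof (rule mult_mono)
      have "\<bar>real l - (1 - s) * real n\<bar> \<le> 3"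
        using k s unfolding l by (simp add: algebra_simps abs_le_iff)
      then show "\<bar>real l / real n - (1 - s)\<bar> \<le> 3 / real n"
        using n0 by (simp add: field_simps abs_le_iff)
    qed (use norm_mu0 in auto)
    moreover have "a - (of_real s * z + of_real (1 - s) * mu0) =
       (of_real (real k / real n - s) * z + e1) + (of_real (real l / real n - (1 - s)) * mu0 + e2)"
      by (simp add: a_def algebra_simps)
    ultimately have "norm (a - (of_real s * z + of_real (1 - s) * mu0))
        \<le> (2 / real n * M + 2 * M\<^sup>2 / real n) + (3 / real n * 1 + 2 * 1\<^sup>2 / real n)"
      by (metis (no_types, lifting) add_mono norm_triangle_mono)
    also have "\<dots> = K / real n" by (simp add: K_def add_divide_distrib)
    also note nK
    finally have close: "norm (a - (of_real s * z + of_real (1 - s) * mu0)) \<le> 1 / 2 ^ 32" .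
    have s': "of_int t / 10 = 1 - s" by (simp add: s_def)
    have "in_ball (mu0 * (1 - exp a)) (chain_step (exp_ball (chain_arg t (x, y, e))) e)"
      using chain_step_sound[OF z(2) t small, of a] close unfolding s' s_def[symmetric] by simp
    moreover have "reachable n (mu0 * (1 - exp a))"
    proof -
      have "norm z < norm (of_nat n :: complex)" using nM(1) n2 by simp
      then have "z \<noteq> of_nat n" by (metis less_irrefl)
      from reachable_step[OF z(1) n0(2) this kl] show ?thesis
        unfolding e1(1) e2(1) a_def exp_add[of "_ + _" "_ + _"] by (simp add: mult.assoc)
    qed
    ultimately show ?case by blast
  qed
qed

text \<open>
  The direction \<open>1 + 2 i\<close> is chosen such that both \<open>z\<close> and \<open>- z\<^sup>2 / \<mu>\<^sub>0\<close> have positive real part, the latter being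
  the leading term of the defect of a doubled forest.
\<close>

definition in_sector :: "real \<Rightarrow> complex \<Rightarrow> bool" where
  "in_sector \<rho> z \<longleftrightarrow> norm (z - of_real \<rho> * Complex 1 2) \<le> \<rho> / 10"

lemma eventually_reachable_in_sector:
  "\<forall>\<^sub>F n in sequentially. \<exists>z. reachable n z \<and> in_sector 112 z"
proof -
  have "\<forall>\<^sub>F n in sequentially. reachable n mu0"
    by (rule eventually_mono[OF eventually_ge_at_top reachable_mu0])
  moreover have "in_ball mu0 (4187593114, - 670014898, 1)"
  proof -
    have "2 ^ 32 * mu0 - Complex (of_int 4187593114) (of_int (- 670014898)) = Complex (2 ^ 32 * 39 / 40 - 4187593114) (670014898 - 2 ^ 32 * 39 / 250)"
      by (simp add: complex_eq_iff mu0_def)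
    also have "norm \<dots> \<le> of_int 1" by (rule order_trans[OF norm_Complex_le]) simp
    finally show ?thesis by simp
  qed
  ultimately have "eventually_reachable (4187593114, - 670014898, 1)"
    unfolding eventually_reachable_def by (auto elim!: eventually_mono simp del: in_ball.simps)
  then have "eventually_reachable (484158253166, 959779535902, 9740339240)"
    by (rule chain_sound[OF escape_chain, rotated]) (auto intro: eventually_reachable_step simp del: small_ball.simps chain_arg.simps chain_step.simps)
  then show ?thesis
    unfolding eventually_reachable_def
  proof eventually_elim
    case (elim n)
    then obtain z where z: "reachable n z" "in_ball z (484158253166, 959779535902, 9740339240)" by blast
    have "2 ^ 32 * norm (z - of_real 112 * Complex 1 2) = norm (2 ^ 32 * (z - of_real 112 * Complex 1 2))"
      by (simp only: norm_mult norm_power norm_numeral)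
    also have "2 ^ 32 * (z - of_real 112 * Complex 1 2) =
       (2 ^ 32 * z - Complex (of_int 484158253166) (of_int 959779535902))
       + Complex (484158253166 - 112 * 2 ^ 32) (959779535902 - 224 * 2 ^ 32)"
      by (simp add: complex_eq_iff)
    also have "norm \<dots> \<le> 9740339240 + (\<bar>484158253166 - 112 * 2 ^ 32\<bar> + \<bar>959779535902 - 224 * 2 ^ 32\<bar>)"
      using z(2) by (intro order_trans[OF norm_triangle_ineq] add_mono norm_Complex_le) simp
    finally have "norm (z - of_real 112 * Complex 1 2) \<le> 112 / 10" by simp
    then show ?case using z(1) unfolding in_sector_def by blast
  qed
qed

section \<open>Growth of defects up to the logarithmic scale\<close>

lemma in_sector_bounds:
  assumes "in_sector \<rho> z"
  shows "9 / 10 * \<rho> \<le> Re z" "Re z \<le> 11 / 10 * \<rho>" "19 / 10 * \<rho> \<le> Im z" "Im z \<le> 21 / 10 * \<rho>"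
    "norm z \<le> 24 / 10 * \<rho>" "0 \<le> \<rho>"
proof -
  define d where "d = z - of_real \<rho> * Complex 1 2"
  have d: "norm d \<le> \<rho> / 10" using assms by (simp add: in_sector_def d_def)
  then show \<rho>: "0 \<le> \<rho>" using norm_ge_zero[of d] by linarith
  have "Re d = Re z - \<rho>" "Im d = Im z - 2 * \<rho>" by (simp_all add: d_def)
  then show "9 / 10 * \<rho> \<le> Re z" "Re z \<le> 11 / 10 * \<rho>" "19 / 10 * \<rho> \<le> Im z" "Im z \<le> 21 / 10 * \<rho>"
    using abs_Re_le_cmod[of d] abs_Im_le_cmod[of d] d by linarith+
  have "norm (Complex 1 2) \<le> 23 / 10" unfolding cmod_def by (rule real_le_lsqrt) (auto simp: power2_eq_square)
  then have "norm (of_real \<rho> * Complex 1 2) \<le> \<rho> * (23 / 10)"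
    unfolding norm_mult norm_of_real using \<rho> by (intro mult_mono) auto
  then show "norm z \<le> 24 / 10 * \<rho>"
    using norm_triangle_ineq[of d "of_real \<rho> * Complex 1 2"] d by (simp add: d_def)
qed

lemma exists_angle:
  fixes v :: complex and Y :: real
  assumes "v \<noteq> 0"
  obtains \<phi> where "Y \<le> \<phi>" "\<phi> \<le> Y + 63 / 10" "v = of_real (norm v) * exp (\<i> * of_real \<phi>)"
proof -
  define m where "m = \<lceil>(Y - Arg v) / (2 * pi)\<rceil>"
  define \<phi> where "\<phi> = Arg v + of_int m * (2 * pi)"
  have "(Y - Arg v) / (2 * pi) \<le> of_int m" "of_int m \<le> (Y - Arg v) / (2 * pi) + 1"
    unfolding m_def by linarith+
  then have "Y \<le> \<phi>" "\<phi> \<le> Y + 2 * pi" by (simp_all add: \<phi>_def field_simps)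
  moreover have "pi < 315 / 100" using pi_approx by simp
  moreover have "v = of_real (norm v) * exp (\<i> * of_real \<phi>)"
    using Arg_eq[OF assms] exp_integer_2pi[of "of_int m"]
    by (simp add: \<phi>_def exp_add distrib_left mult.assoc mult.commute mult.left_commute)
  ultimately show ?thesis using that by simp
qed

text \<open>
  The number \<open>k\<close> of copies determines the exponent \<open>k / n * z\<close>. The imaginary part of \<open>z\<close> is large, so \<open>k\<close> can
  be chosen to bring the imaginary part of the exponent to any angle \<open>\<phi>\<close>, up to the small step width;
  asking for \<open>\<phi> \<ge> 5 / 2 ln (5 \<rho>)\<close> makes the real part at least \<open>ln (5 \<rho>)\<close>, as the slope in the sector is known.
\<close>

lemma growth_exponent:
  assumes sec: "in_sector \<rho> z" and \<rho>: "100 \<le> \<rho>" and n: "\<rho> ^ 4 \<le> real n" and "v \<noteq> 0"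
  obtains k \<phi> where "0 < k" "2 * k < n" "v = of_real (norm v) * exp (\<i> * of_real \<phi>)"
    "\<bar>of_nat k / of_nat n * Im z - \<phi>\<bar> \<le> 1 / 1000"
    "ln (5 * \<rho>) \<le> of_nat k / of_nat n * Re z" "of_nat k / of_nat n * Re z \<le> 2 * ln (5 * \<rho>) + 4"
proof -
  define Y where "Y = 5 / 2 * ln (5 * \<rho>)"
  obtain \<phi> where \<phi>: "Y \<le> \<phi>" "\<phi> \<le> Y + 63 / 10" "v = of_real (norm v) * exp (\<i> * of_real \<phi>)"
    using exists_angle[OF assms(4)] by blast
  note b = in_sector_bounds[OF sec]
  have y: "0 < Im z" and x: "0 < Re z" using b \<rho> by linarith+
  have rn: "\<rho> * 1000000 \<le> real n"
  proof -
    have "\<rho> * 100 ^ 3 \<le> \<rho> * \<rho> ^ 3" using \<rho> by (intro mult_left_mono power_mono) auto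
    also have "\<dots> = \<rho> ^ 4" by (simp add: power_numeral_reduce)
    finally show ?thesis using n by simp
  qed
  then have n0: "0 < real n" "1000 \<le> real n" using \<rho> by linarith+
  have ln5: "0 < ln (5 * \<rho>)" using \<rho> by simp
  have ln_le: "ln (5 * \<rho>) \<le> 3 + \<rho> / 10"
  proof -
    have "ln (5 * \<rho>) = ln (50 * (\<rho> / 10))" by simp
    also have "\<dots> = ln 50 + ln (\<rho> / 10)" using \<rho> by (subst ln_mult) auto
    also have "ln (\<rho> / 10) \<le> \<rho> / 10 - 1" using \<rho> by (intro ln_le_minus_one) auto
    also have "ln (50 :: real) \<le> 4"
    proof -
      have "(27 / 10 :: real) \<le> exp 1" 
      proof -
        have "inverse (2 ^ 32) \<le> (1 / 100 :: real)" by simp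
        then show ?thesis using e_approx_32 by linarith
      qed
      then have "(27 / 10 :: real) ^ 4 \<le> exp 1 ^ 4" by (intro power_mono) auto
      moreover have "(50 :: real) \<le> (27 / 10) ^ 4" by (simp add: eval_nat_numeral)
      moreover have "exp 1 ^ 4 = exp (4 :: real)" by (simp flip: exp_of_nat_mult)
      ultimately have "(50 :: real) \<le> exp 4" by linarith
      then show ?thesis using ln_le_cancel_iff[of 50 "exp 4"] by simp
    qed
    finally show ?thesis by simp
  qed
  \<comment> \<open>Rounding up changes the angle by at most the step width.\<close>
  define k where "k = nat \<lceil>\<phi> * real n / Im z\<rceil>"
  have \<phi>0: "0 < \<phi>" using \<phi>(1) ln5 by (simp add: Y_def)
  then have q: "0 < \<phi> * real n / Im z" using n0 y by simp
  then have k: "\<phi> * real n / Im z \<le> real k" "real k \<le> \<phi> * real n / Im z + 1" "0 < k"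
    unfolding k_def by linarith+
  have low: "\<phi> \<le> real k / real n * Im z" using k(1) n0 y by (simp add: field_simps)
  have up: "real k / real n * Im z \<le> \<phi> + 1 / 1000"
  proof -
    have "real k / real n * Im z \<le> (\<phi> * real n / Im z + 1) / real n * Im z"
      using k(2) n0 y by (intro mult_right_mono divide_right_mono) auto
    also have "\<dots> = \<phi> + Im z / real n" using n0 y by (simp add: field_simps)
    also have "Im z / real n \<le> 1 / 1000" using b(4) rn n0 \<rho> by (simp add: field_simps)
    finally show ?thesis by simp
  qed
  have "2 * k < n"
  proof -
    have "\<phi> \<le> 15 + \<rho> / 4" using \<phi>(2) ln_le by (simp add: Y_def)
    then have "\<phi> \<le> Im z * (23 / 100)" using b(3) \<rho> by simp
    then have "real k / real n * Im z \<le> 24 / 100 * Im z"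
      using up b(3) \<rho> by simp
    then have "real k / real n \<le> 24 / 100" by (rule mult_right_le_imp_le[OF _ y])
    then have "real (2 * k) < real n" using n0 by (simp add: field_simps)
    then show ?thesis by simp
  qed
  have s: "0 \<le> real k / real n" by simp
  have "2 / 5 * Im z \<le> Re z" "Re z \<le> 3 / 5 * Im z" using b \<rho> by linarith+
  then have xy: "2 / 5 * (real k / real n * Im z) \<le> real k / real n * Re z"
    "real k / real n * Re z \<le> 3 / 5 * (real k / real n * Im z)"
    using mult_left_mono[OF _ s] by (metis mult.left_commute)+
  have "ln (5 * \<rho>) \<le> real k / real n * Re z"
  proof -
    have "l \<le> 2 / 5 * A" if "f \<le> A" "5 / 2 * l \<le> f" for A f l :: real using that by linarith
    then show ?thesis using order_trans[OF _ xy(1)] low \<phi>(1) unfolding Y_def by blast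
  qed
  moreover have "real k / real n * Re z \<le> 2 * ln (5 * \<rho>) + 4"
  proof -
    have "3 / 5 * A \<le> 2 * l + 4" if "A \<le> f + 1 / 1000" "f \<le> 5 / 2 * l + 63 / 10" "0 < l" for A f l :: real
      using that by linarith
    then show ?thesis using order_trans[OF xy(2)] up \<phi>(2) ln5 unfolding Y_def by blast
  qed
  moreover have "\<bar>real k / real n * Im z - \<phi>\<bar> \<le> 1 / 1000"
  proof -
    have "\<bar>A - f\<bar> \<le> 1 / 1000" if "f \<le> A" "A \<le> f + 1 / 1000" for A f :: real using that by linarith
    then show ?thesis using low up by blast
  qed
  ultimately show ?thesis using that[of k \<phi>] k(3) \<open>2 * k < n\<close> \<phi>(3) by simp
qed

text \<open>
  The new defect is essentially \<open>- \<mu>\<^sub>0\<close> times the exponential. The angle is chosen such that this points in the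
  direction \<open>1 + 2 i\<close>, and the size at least doubles. The upper bound \<open>\<rho> ^ 4\<close> keeps the size
  under control when the iteration is stopped, and fewer than \<open>n / 2\<close> copies are used so that the resulting forest
  can be doubled.
\<close>

lemma growth_step:
  assumes sec: "in_sector \<rho> z" and \<rho>: "100 \<le> \<rho>" and n: "\<rho> ^ 4 \<le> real n"
  obtains k \<rho>' where "0 < k" "2 * k < n" "2 * \<rho> \<le> \<rho>'" "\<rho>' \<le> \<rho> ^ 4"
    "in_sector \<rho>' (mu0 * (1 - (1 / (1 - z / of_nat n)) ^ k))"
proof -
  define v where "v = - Complex 1 2 / mu0"
  have "v \<noteq> 0" by (simp add: v_def mu0_nonzero Complex_eq_0)
  from growth_exponent[OF sec \<rho> n this] obtain k \<phi> where k: "0 < k" "2 * k < n"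
    and \<phi>: "v = of_real (norm v) * exp (\<i> * of_real \<phi>)" "\<bar>of_nat k / of_nat n * Im z - \<phi>\<bar> \<le> 1 / 1000"
    and X: "ln (5 * \<rho>) \<le> of_nat k / of_nat n * Re z" "of_nat k / of_nat n * Re z \<le> 2 * ln (5 * \<rho>) + 4"
    by blast
  note b = in_sector_bounds[OF sec]
  have \<rho>2: "10000 \<le> \<rho>\<^sup>2" using power_mono[OF \<rho>, of 2] by simp
  have n2: "10000 * \<rho>\<^sup>2 \<le> real n"
  proof -
    have "10000 * \<rho>\<^sup>2 \<le> \<rho>\<^sup>2 * \<rho>\<^sup>2" using \<rho>2 by (intro mult_right_mono) auto
    then show ?thesis using n by (simp flip: power_add)
  qed
  have z2: "(norm z)\<^sup>2 \<le> (24 / 10 * \<rho>)\<^sup>2" using b(5) by (intro power_mono) auto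
  have rr: "\<rho> \<le> \<rho>\<^sup>2" using \<rho> by (simp add: power2_eq_square)
  have n0: "0 < n" using n2 \<rho>2 by (cases n) auto
  have zn: "norm z \<le> real n / 2" using b(5) n2 rr \<rho>2 by linarith
  obtain err where err: "(1 / (1 - z / of_nat n)) ^ k = exp (of_real (of_nat k / of_nat n) * z + err)"
    "norm err \<le> 2 * of_nat k * (norm z)\<^sup>2 / (of_nat n)\<^sup>2"
    using power_eq_exp[OF zn n0] by blast
  have "norm err \<le> 2 * of_nat k * (norm z)\<^sup>2 / (of_nat n)\<^sup>2" by (rule err(2))
  also have "\<dots> \<le> of_nat n * (24 / 10 * \<rho>)\<^sup>2 / (of_nat n)\<^sup>2"
    using k z2 by (intro divide_right_mono mult_mono) auto
  also have "\<dots> = (24 / 10 * \<rho>)\<^sup>2 / real n" using n0 by (simp add: power2_eq_square)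
  also have "\<dots> \<le> 1 / 1000"
  proof -
    have "(24 / 10 * \<rho>)\<^sup>2 \<le> 6 * \<rho>\<^sup>2" by (simp add: power_mult_distrib power2_eq_square)
    then have "(24 / 10 * \<rho>)\<^sup>2 \<le> real n / 1000" using n2 by linarith
    then show ?thesis using n0 by (simp add: field_simps)
  qed
  finally have err_small: "norm err \<le> 1 / 1000" .
  define x where "x = of_nat k / of_nat n * Re z"
  define \<delta> where "\<delta> = of_nat k / of_nat n * Im z - \<phi>"
  have \<delta>: "\<bar>\<delta>\<bar> \<le> 1 / 1000" using \<phi>(2) by (simp add: \<delta>_def)
  define \<eta> where "\<eta> = \<i> * of_real \<delta> + err"
  have "norm \<eta> \<le> 1 / 1000 + 1 / 1000"
    unfolding \<eta>_def by (intro order_trans[OF norm_triangle_ineq] add_mono err_small)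
      (use \<delta> in \<open>simp add: norm_mult\<close>)
  then have \<eta>: "norm \<eta> \<le> 1 / 500" by simp
  have expo: "of_real (of_nat k / of_nat n) * z + err = of_real x + \<i> * of_real \<phi> + \<eta>"
    by (simp add: x_def \<delta>_def \<eta>_def complex_eq_iff algebra_simps)
  define c where "c = 1 / norm v"
  have nv: "norm v \<noteq> 0" using \<open>v \<noteq> 0\<close> by simp
  have rot: "- mu0 * exp (\<i> * of_real \<phi>) = of_real c * Complex 1 2"
  proof -
    have "Complex 1 2 = - mu0 * v" by (simp add: v_def mu0_nonzero)
    also have "\<dots> = of_real (norm v) * (- mu0 * exp (\<i> * of_real \<phi>))"
      by (subst \<phi>(1)) (simp add: mult_ac)
    finally show ?thesis using nv by (simp add: c_def field_simps)
  qed
  have c_sq: "c ^ 2 = 974961 / 5000000"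
  proof -
    have "norm v ^ 2 = norm (Complex 1 2) ^ 2 / norm mu0 ^ 2"
      by (simp add: v_def norm_divide power_divide)
    also have "\<dots> = 5 / (974961 / 1000000)"
      unfolding cmod_power2 mu0_def by (simp add: power2_eq_square)
    finally have nv2: "norm v ^ 2 = 5 / (974961 / 1000000)" .
    have "c ^ 2 = 1 / norm v ^ 2" by (simp add: c_def power_divide)
    then show ?thesis unfolding nv2 by simp
  qed
  have c0: "0 \<le> c" by (simp add: c_def)
  have c: "2 / 5 \<le> c" "c \<le> 1 / 2"
  proof -
    have "(2 / 5)\<^sup>2 \<le> c\<^sup>2" "c\<^sup>2 \<le> (1 / 2)\<^sup>2" unfolding c_sq by (simp_all add: power2_eq_square)
    then show "2 / 5 \<le> c" "c \<le> 1 / 2" using c0 by (auto elim: power2_le_imp_le)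
  qed
  define \<rho>' where "\<rho>' = c * exp x"
  have "5 * \<rho> \<le> exp x"
    using X(1) \<rho> unfolding x_def by (metis exp_le_cancel_iff exp_ln less_le_trans mult_pos_pos zero_less_numeral)
  then have "2 / 5 * (5 * \<rho>) \<le> \<rho>'" unfolding \<rho>'_def using c \<rho> by (intro mult_mono) auto
  then have low: "2 * \<rho> \<le> \<rho>'" by simp
  have "exp x \<le> exp (2 * ln (5 * \<rho>) + 4)" using X(2) by (simp add: x_def)
  also have "\<dots> = (exp (ln (5 * \<rho>)))\<^sup>2 * exp 1 ^ 4"
    unfolding exp_add by (simp flip: exp_of_nat_mult)
  also have "\<dots> \<le> (5 * \<rho>)\<^sup>2 * 3 ^ 4"
    using \<rho> exp_le by (intro mult_mono power_mono) auto
  finally have "\<rho>' \<le> 1 / 2 * ((5 * \<rho>)\<^sup>2 * 3 ^ 4)"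
    unfolding \<rho>'_def using c by (intro mult_mono) auto
  also have "\<dots> \<le> 10000 * \<rho>\<^sup>2" by (simp add: power_mult_distrib)
  also have "\<dots> \<le> \<rho>\<^sup>2 * \<rho>\<^sup>2" using \<rho>2 by (intro mult_right_mono) auto
  also have "\<dots> = \<rho> ^ 4" by (simp flip: power_add)
  finally have high: "\<rho>' \<le> \<rho> ^ 4" .
  have "mu0 * (1 - (1 / (1 - z / of_nat n)) ^ k) = mu0 + of_real (exp x) * (- mu0 * exp (\<i> * of_real \<phi>)) * exp \<eta>"
    unfolding err(1) expo exp_add by (simp add: algebra_simps exp_of_real)
  also have "\<dots> = mu0 + of_real \<rho>' * Complex 1 2 * exp \<eta>"
    unfolding rot by (simp add: \<rho>'_def mult_ac)
  finally have "mu0 * (1 - (1 / (1 - z / of_nat n)) ^ k) - of_real \<rho>' * Complex 1 2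
      = mu0 + of_real \<rho>' * Complex 1 2 * (exp \<eta> - 1)" by (simp add: algebra_simps)
  also have "norm \<dots> \<le> 1 + \<rho>' * 3 * (1 / 250)"
  proof (intro order_trans[OF norm_triangle_ineq] add_mono norm_mu0)
    have "norm (Complex 1 2) \<le> 3" using norm_Complex_le[of 1 2] by simp
    moreover have "norm (exp \<eta> - 1) \<le> 1 / 250"
    proof -
      have "norm \<eta> ^ 2 \<le> (1 / 500)\<^sup>2" using \<eta> by (intro power_mono) auto
      then show ?thesis using norm_exp_minus_one[of \<eta>] \<eta> by (simp add: power2_eq_square)
    qed
    moreover have "0 \<le> \<rho>'" using low \<rho> by simp
    ultimately show "norm (of_real \<rho>' * Complex 1 2 * (exp \<eta> - 1)) \<le> \<rho>' * 3 * (1 / 250)"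
      unfolding norm_mult norm_of_real by (intro mult_mono) auto
  qed
  also have "\<dots> \<le> \<rho>' / 10" using low \<rho> by simp
  finally have "in_sector \<rho>' (mu0 * (1 - (1 / (1 - z / of_nat n)) ^ k))" by (simp add: in_sector_def)
  then show ?thesis using that k low high by blast
qed

text \<open>
  Iterates the growth until the size exceeds \<open>L\<close> and makes one further step, which exhibits the
  final forest as copies of a single tree.
\<close>

lemma reachable_far:
  assumes "reachable n z\<^sub>0" "in_sector 112 z\<^sub>0" "112 \<le> L" "L ^ 64 \<le> real n"
  obtains u k \<rho> where "grown n u" "diff_wt u (of_nat n / mu0) \<noteq> 0" "0 < k" "2 * k < n" "L \<le> \<rho>" "\<rho> \<le> L ^ 16"
    "in_sector \<rho> (mu0 * (1 - (1 / (1 - defect n u mu0 / of_nat n)) ^ k))"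
    "norm (defect n u mu0) \<le> real n / 2"
proof -
  have pow: "L ^ i \<le> L ^ j" if "i \<le> j" for i j
    using assms(3) that by (intro power_increasing) auto
  have L4: "L ^ 4 \<le> real n" "(L ^ 4) ^ 4 \<le> real n"
    using pow[of 4 64] pow[of 16 64] assms(4) by (simp_all flip: power_mult)
  have n2: "2 \<le> n" 
    using pow[of 1 64] assms by simp
  have small: "norm z \<le> real n / 2" if "in_sector \<rho> z" "100 \<le> \<rho>" "\<rho> ^ 4 \<le> real n" for \<rho> z
  proof -
    have "\<rho> * 100 ^ 3 \<le> \<rho> * \<rho> ^ 3" using that by (intro mult_left_mono power_mono) auto
    also have "\<dots> = \<rho> ^ 4" by (simp add: power_numeral_reduce)
    finally show ?thesis using in_sector_bounds(5)[OF that(1)] that by simp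
  qed
  have "\<exists>\<rho> z. reachable n z \<and> in_sector \<rho> z \<and> 100 \<le> \<rho> \<and> \<rho> \<le> L ^ 4 \<and> (L \<le> \<rho> \<or> 2 ^ j \<le> \<rho>)" for j
  proof (induction j)
    case 0
    show ?case using assms(1-3) pow[of 1 4] by (intro exI[of _ 112] exI[of _ z\<^sub>0]) auto
  next
    case (Suc j)
    then obtain \<rho> z where IH: "reachable n z" "in_sector \<rho> z" "100 \<le> \<rho>" "\<rho> \<le> L ^ 4" "L \<le> \<rho> \<or> 2 ^ j \<le> \<rho>"
      by blast
    show ?case
    proof (cases "L \<le> \<rho>")
      case False
      have \<rho>4: "\<rho> ^ 4 \<le> L ^ 4" using False IH(3) by (intro power_mono) auto
      then have \<rho>n: "\<rho> ^ 4 \<le> real n" using L4(1) by linarith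
      obtain k \<rho>' where g: "0 < k" "2 * k < n" "2 * \<rho> \<le> \<rho>'" "\<rho>' \<le> \<rho> ^ 4"
        "in_sector \<rho>' (mu0 * (1 - (1 / (1 - z / of_nat n)) ^ k))"
        using growth_step[OF IH(2,3) \<rho>n] by blast
      have "norm z < norm (of_nat n :: complex)" using small[OF IH(2,3) \<rho>n] n2 by simp
      then have "z \<noteq> of_nat n" by (metis less_irrefl)
      from reachable_step[OF IH(1) n2 this, of k 0] g have "reachable n (mu0 * (1 - (1 / (1 - z / of_nat n)) ^ k))"
        by simp
      moreover have "\<rho>' \<le> L ^ 4" using g(4) \<rho>4 by linarith
      moreover have "100 \<le> \<rho>'" "2 ^ Suc j \<le> \<rho>'" using g(3) IH(3,5) False by auto
      ultimately show ?thesis using g(5) by blast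
    qed (use IH in blast)
  qed
  moreover obtain j where "L < 2 ^ j" using real_arch_pow[of 2 L] by auto
  ultimately obtain \<rho> z where z: "reachable n z" "in_sector \<rho> z" "100 \<le> \<rho>" "\<rho> \<le> L ^ 4" "L \<le> \<rho>"
    by (meson less_le_trans order.strict_implies_order)
  have "\<rho> ^ 4 \<le> (L ^ 4) ^ 4" using z by (intro power_mono) auto
  then have \<rho>: "\<rho> ^ 4 \<le> real n" "\<rho> ^ 4 \<le> L ^ 16" using L4 by (simp_all flip: power_mult)
  obtain k \<rho>' where g: "0 < k" "2 * k < n" "2 * \<rho> \<le> \<rho>'" "\<rho>' \<le> \<rho> ^ 4"
    "in_sector \<rho>' (mu0 * (1 - (1 / (1 - z / of_nat n)) ^ k))"
    using growth_step[OF z(2,3) \<rho>(1)] by blast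
  obtain u where u: "grown n u" "diff_wt u (of_nat n / mu0) \<noteq> 0" "defect n u mu0 = z"
    using z(1) by (auto simp: reachable_def)
  show ?thesis
    by (rule that[OF u(1,2) g(1,2), of \<rho>']) (use g z \<rho> u small[OF z(2,3) \<rho>(1)] in auto)
qed

section \<open>Rigidity in a zero-free parameter disc\<close>

text \<open>
  The distance of \<open>\<mu>\<^sub>0\<close> to the boundary of the disc \<open>Re (1 / \<mu>) \<ge> 1\<close> is about 0.00004.
\<close>

abbreviation parameter_disc :: "complex set" where
  "parameter_disc \<equiv> cball mu0 (1 / 100000)"

text \<open>
  By \<open>chromatic_poly_leaf_joined_tree\<close> with \<open>q = 1 + n / \<mu>\<close>, a violation yields a chromatic zero. Trees whose root
  has \<open>n\<close> children are included, since the root has no parent.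
\<close>

definition zero_free :: "nat \<Rightarrow> bool" where
  "zero_free n \<longleftrightarrow> (\<forall>\<mu>\<in>parameter_disc. \<forall>us. us \<noteq> [] \<longrightarrow> length us \<le> n \<longrightarrow> (\<forall>u\<in>set us. grown n u) \<longrightarrow>
     same_wt (map Node us) (of_nat n / \<mu>) + of_nat n / \<mu> * diff_wt (map Node us) (of_nat n / \<mu>) \<noteq> 0)"

lemma zero_freeD:
  assumes "zero_free n" "\<mu> \<in> parameter_disc" "us \<noteq> []" "length us \<le> n" "\<And>u. u \<in> set us \<Longrightarrow> grown n u"
  shows "same_wt (map Node us) (of_nat n / \<mu>) + of_nat n / \<mu> * diff_wt (map Node us) (of_nat n / \<mu>) \<noteq> 0"
  using assms unfolding zero_free_def by blast

lemma norm_mu0_ge: "9 / 10 \<le> norm mu0"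
  using abs_Re_le_cmod[of mu0] by (simp add: mu0_def)

lemma inverse_norm_mu0_le: "1 / norm mu0 \<le> 10 / 9"
proof -
  have "1 / norm mu0 \<le> 1 / (9 / 10)" by (rule divide_left_mono) (use norm_mu0_ge in auto)
  then show ?thesis by simp
qed

lemma parameter_disc_facts:
  assumes "\<mu> \<in> parameter_disc"
  shows "\<mu> \<noteq> 0" "norm \<mu> \<le> 1" "Re (1 / \<mu>) \<ge> 1"
proof -
  have d: "norm (\<mu> - mu0) \<le> 1 / 100000" using assms by (simp add: dist_norm norm_minus_commute)
  have m: "norm mu0 \<le> 9875 / 10000" "norm (mu0 - 1 / 2) \<le> 49997 / 100000"
    unfolding cmod_def mu0_def by (rule real_le_lsqrt; simp add: power2_eq_square)+
  show "norm \<mu> \<le> 1" using norm_triangle_ineq[of "\<mu> - mu0" mu0] d m(1) by simp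
  have "norm (\<mu> - 1 / 2) \<le> 1 / 2" using norm_triangle_ineq[of "\<mu> - mu0" "mu0 - 1 / 2"] d m(2) by simp
  then have "norm (\<mu> - 1 / 2) ^ 2 \<le> (1 / 2) ^ 2" by (intro power_mono) auto
  then have le: "(Re \<mu>)\<^sup>2 + (Im \<mu>)\<^sup>2 \<le> Re \<mu>" unfolding cmod_power2 by (simp add: power2_eq_square algebra_simps)
  have "9 / 10 \<le> Re mu0" by (simp add: mu0_def)
  then have "0 < Re \<mu>" using abs_Re_le_cmod[of "\<mu> - mu0"] d by simp
  then show "\<mu> \<noteq> 0" by auto
  have "0 < (Re \<mu>)\<^sup>2 + (Im \<mu>)\<^sup>2" using \<open>0 < Re \<mu>\<close> by (simp add: add_pos_nonneg)
  then show "Re (1 / \<mu>) \<ge> 1" using le by (simp add: Re_divide)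
qed

text \<open>
  The quotient of the weights of a forest has a pole only if some tree in it has a vanishing second weight. Such a
  point is a zero of another tree: adding a star as a further child of the root multiplies the quotient by
  \<open>x / (x - 1)\<close>, which moves the value \<open>1 - x\<close> to \<open>- x\<close>.
\<close>

lemma zero_free_weights_nonzero:
  assumes zf: "zero_free n" and n: "2 \<le> n" and \<mu>: "\<mu> \<in> parameter_disc" and u: "grown n u"
  shows "diff_wt u (of_nat n / \<mu>) \<noteq> 0
    \<and> same_wt u (of_nat n / \<mu>) + (of_nat n / \<mu> - 1) * diff_wt u (of_nat n / \<mu>) \<noteq> 0"
  using u
proof (induction rule: grown.induct)
  case star
  have "norm \<mu> < norm (of_nat n :: complex)" using parameter_disc_facts(2)[OF \<mu>] n by simp
  then have "of_nat n / \<mu> \<noteq> 1" using parameter_disc_facts(1)[OF \<mu>] by (metis divide_eq_1_iff less_irrefl)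
  then show ?case by (simp add: wt_star[OF n])
next
  case (node us)
  define x where "x = of_nat n / \<mu>"
  have x: "x \<noteq> 0" using parameter_disc_facts(1)[OF \<mu>] n by (simp add: x_def)
  have ne: "u \<noteq> []" if "grown n u" for u using grown_nonempty[OF that n] .
  have diff: "diff_wt (map Node us) x \<noteq> 0"
  proof -
    have "\<forall>u\<in>set us. u \<noteq> [] \<and> same_wt u x + (x - 1) * diff_wt u x \<noteq> 0"
      using node(3) ne by (auto simp: x_def)
    then show ?thesis by (induction us) auto
  qed
  have "same_wt (map Node (star n # us)) x + x * diff_wt (map Node (star n # us)) x \<noteq> 0"
    using node unfolding x_def by (intro zero_freeD[OF zf \<mu>]) (auto intro: grown.star)
  moreover have "same_wt (map Node (star n # us)) x + x * diff_wt (map Node (star n # us)) x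
      = x * (same_wt (map Node us) x + (x - 1) * diff_wt (map Node us) x)"
    using ne[OF grown.star] by (simp add: wt_star[OF n] algebra_simps)
  ultimately show ?case using diff x by (auto simp: x_def)
qed

lemma wt_holomorphic: "same_wt u holomorphic_on S" "diff_wt u holomorphic_on S"
proof -
  obtain p r where "\<And>x. same_wt u x = poly p x" "\<And>x. diff_wt u x = poly r x"
    using wt_polynomial[of u] by blast
  then show "same_wt u holomorphic_on S" "diff_wt u holomorphic_on S"
    by (auto intro!: holomorphic_intros simp: fun_eq_iff cong: holomorphic_cong)
qed

lemma zero_free_defect:
  assumes zf: "zero_free n" and n: "2 \<le> n" and u: "grown n u"
  shows "defect n u holomorphic_on parameter_disc"
    "\<And>\<mu>. \<mu> \<in> parameter_disc \<Longrightarrow> defect n u \<mu> \<noteq> of_nat n"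
proof -
  let ?D = "parameter_disc"
  have "(same_wt u \<circ> (\<lambda>\<mu>. of_nat n / \<mu>)) holomorphic_on ?D" "(diff_wt u \<circ> (\<lambda>\<mu>. of_nat n / \<mu>)) holomorphic_on ?D"
    using parameter_disc_facts(1) by (intro holomorphic_on_compose wt_holomorphic holomorphic_intros; auto)+
  then show "defect n u holomorphic_on ?D"
    using zero_free_weights_nonzero[OF zf n _ u] unfolding defect_def comp_def
    by (intro holomorphic_intros) auto
  show "defect n u \<mu> \<noteq> of_nat n" if \<mu>: "\<mu> \<in> ?D" for \<mu>
  proof
    assume "defect n u \<mu> = of_nat n"
    then show False
      using child_weight[of n \<mu> u] zero_free_weights_nonzero[OF zf n \<mu> u] parameter_disc_facts(1)[OF \<mu>] n by auto
  qed
qed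

text \<open>
  The quotient of the weights of \<open>m\<close> copies, divided by the value \<open>- n / \<mu>\<close> that corresponds to a zero.
\<close>

definition target_quotient :: "nat \<Rightarrow> rtree list \<Rightarrow> nat \<Rightarrow> complex \<Rightarrow> complex" where
  "target_quotient n u m \<mu> = - \<mu> / of_nat n * (1 / (1 - defect n u \<mu> / of_nat n)) ^ m"

lemma target_quotient_omits:
  assumes zf: "zero_free n" and n: "2 \<le> n" and u: "grown n u" and m: "0 < m" "m \<le> n"
    and \<mu>: "\<mu> \<in> parameter_disc"
  shows "target_quotient n u m \<mu> \<noteq> 0" "target_quotient n u m \<mu> \<noteq> 1"
proof -
  define x where "x = of_nat n / \<mu>"
  have \<mu>0: "\<mu> \<noteq> 0" by (rule parameter_disc_facts(1)[OF \<mu>])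
  have n0: "0 < n" using n by simp
  note nz = zero_free_weights_nonzero[OF zf n \<mu> u] zero_free_defect(2)[OF zf n u \<mu>]
  have "1 - defect n u \<mu> / of_nat n \<noteq> 0" using nz(2) n0 by (simp add: field_simps)
  then show "target_quotient n u m \<mu> \<noteq> 0" using \<mu>0 n0 by (simp add: target_quotient_def)
  note R = ratio_replicate_Node[OF n0 \<mu>0 conjunct1[OF nz(1)] nz(2) grown_nonempty[OF u n], of m, folded x_def]
  have inv: "r = - x" if "- \<mu> / of_nat n * r = 1" for r
  proof -
    have "- (\<mu> * r) = of_nat n" using that n0 by (simp add: field_simps)
    then have "\<mu> * r = - of_nat n" by (metis add.inverse_inverse)
    then show ?thesis using \<mu>0 by (simp add: x_def field_simps)
  qed
  show "target_quotient n u m \<mu> \<noteq> 1"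
  proof
    assume "target_quotient n u m \<mu> = 1"
    then have "same_wt (replicate m (Node u)) x / diff_wt (replicate m (Node u)) x = - x"
      unfolding target_quotient_def R(2)[symmetric] by (rule inv)
    then have "same_wt (replicate m (Node u)) x + x * diff_wt (replicate m (Node u)) x = 0"
      using R(1) by (simp add: field_simps)
    moreover have "same_wt (map Node (replicate m u)) x + x * diff_wt (map Node (replicate m u)) x \<noteq> 0"
      using m u unfolding x_def by (intro zero_freeD[OF zf \<mu>]) auto
    ultimately show False by simp
  qed
qed

text \<open>
  Schottky's theorem bounds the function on the disc of half the radius, and Cauchy's estimate then
  bounds the derivative at the centre.
\<close>

lemma omitting_derivative_bound:
  "\<exists>C>0. \<forall>f. f holomorphic_on parameter_disc \<longrightarrow> (\<forall>\<mu>\<in>parameter_disc. f \<mu> \<noteq> 0 \<and> f \<mu> \<noteq> 1)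
      \<longrightarrow> norm (f mu0) \<le> 1 \<longrightarrow> norm (deriv f mu0) \<le> C"
proof -
  define M :: real where "M = exp (pi * exp (pi * (2 + 2 * 1 + 12 * (1 / 2) / (1 - 1 / 2))))"
  have bound: "norm (deriv f mu0) \<le> M / (1 / 200000)"
    if hol: "f holomorphic_on parameter_disc"
      and omit: "\<forall>\<mu>\<in>parameter_disc. f \<mu> \<noteq> 0 \<and> f \<mu> \<noteq> 1" and f0: "norm (f mu0) \<le> 1" for f
  proof -
    define g where "g = f \<circ> (\<lambda>\<zeta>. mu0 + \<zeta> / 100000)"
    have img: "(\<lambda>\<zeta>. mu0 + \<zeta> / 100000) ` cball 0 1 \<subseteq> parameter_disc"
      by (auto simp: dist_norm norm_divide)
    have g: "g holomorphic_on cball 0 1"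
      unfolding g_def using hol img
      by (intro holomorphic_on_compose holomorphic_intros) (auto intro: holomorphic_on_subset)
    have g01: "\<not> (g z = 0 \<or> g z = 1)" if "z \<in> cball 0 1" for z
    proof -
      have "mu0 + z / 100000 \<in> parameter_disc" using img that by blast
      then show ?thesis using omit by (auto simp: g_def)
    qed
    have gM: "norm (g z) \<le> M" if "norm z \<le> 1 / 2" for z
      using Schottky[OF g _ g01, of 1 "1 / 2" z] that f0 by (simp add: g_def M_def)
    have "norm ((deriv ^^ 1) f mu0) \<le> fact 1 * M / (1 / 200000) ^ 1"
    proof (rule Cauchy_inequality)
      show "f holomorphic_on ball mu0 (1 / 200000)" "continuous_on (cball mu0 (1 / 200000)) f"
        using hol by (auto intro!: holomorphic_on_subset[OF hol] holomorphic_on_imp_continuous_on)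
      fix x assume x: "norm (mu0 - x) = 1 / 200000"
      have "norm ((x - mu0) * 100000) = norm (mu0 - x) * 100000"
        unfolding norm_mult by (simp add: norm_minus_commute)
      then have "norm (g ((x - mu0) * 100000)) \<le> M" using x by (intro gM) simp
      moreover have "(x - mu0) * 100000 / 100000 = x - mu0"
        by (rule nonzero_mult_div_cancel_right) simp
      ultimately show "norm (f x) \<le> M" unfolding g_def comp_def by (metis add_diff_cancel_left' diff_add_cancel add.commute)
    qed auto
    then show ?thesis by simp
  qed
  have "0 < M / (1 / 200000)" by (simp add: M_def)
  with bound show ?thesis by blast
qed


lemma log_derivative_target_quotient:
  assumes D: "(defect n u has_field_derivative D) (at \<mu>)" and "defect n u \<mu> \<noteq> of_nat n" "0 < n" "\<mu> \<noteq> 0"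
  shows "(target_quotient n u m has_field_derivative
     target_quotient n u m \<mu> * (1 / \<mu> + of_nat m * D / (of_nat n * (1 - defect n u \<mu> / of_nat n)))) (at \<mu>)"
proof -
  define w where "w = (\<lambda>\<mu>. 1 - defect n u \<mu> / of_nat n)"
  have tq: "target_quotient n u m = (\<lambda>\<mu>. - \<mu> / of_nat n * (1 / w \<mu>) ^ m)"
    by (simp add: target_quotient_def w_def fun_eq_iff)
  have wmu: "1 - defect n u \<mu> / of_nat n = w \<mu>" by (simp add: w_def)
  have w0: "w \<mu> \<noteq> 0" using assms by (simp add: w_def field_simps)
  have "(w has_field_derivative (- D / of_nat n)) (at \<mu>)"
    unfolding w_def using assms(3) by (auto intro!: derivative_eq_intros D)
  note dw = this
  have "((\<lambda>\<mu>. 1 / w \<mu>) has_field_derivative (D / of_nat n / (w \<mu>)\<^sup>2)) (at \<mu>)"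
    using w0 by (auto intro!: derivative_eq_intros dw simp: power2_eq_square field_simps)
  note di = this
  have "((\<lambda>\<mu>. (1 / w \<mu>) ^ m) has_field_derivative (of_nat m * (1 / w \<mu>) ^ m * (D / (of_nat n * w \<mu>)))) (at \<mu>)"
  proof (cases m)
    case (Suc k)
    show ?thesis
      by (rule DERIV_cong[OF DERIV_power[OF di]])
        (use w0 assms(3) Suc in \<open>simp add: power2_eq_square field_simps\<close>)
  qed (simp)
  note dp = this
  have lin: "((\<lambda>\<mu>. - \<mu> / of_nat n) has_field_derivative (- 1 / of_nat n)) (at \<mu>)"
    using assms(3) by (auto intro!: derivative_eq_intros)
  show ?thesis
    unfolding tq wmu
    by (rule DERIV_cong[OF DERIV_mult[OF lin dp]]) (use assms(3,4) w0 in \<open>simp add: field_simps\<close>)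
qed

text \<open>
  The modulus of \<open>target_quotient\<close> for \<open>m\<close> copies grows roughly like \<open>exp (m Re z / n) / n\<close>. For the largest
  \<open>m\<close> that keeps it at most 1 at \<open>\<mu>\<^sub>0\<close> it is also bounded below, so the bound on the derivative is
  one on the logarithmic derivative \<open>1 / \<mu> + m z' / (n - z)\<close>. Since \<open>m\<close> is of order \<open>n ln n / Re z\<close>, the
  bound on \<open>z'\<close> follows; the assumption \<open>Re z \<ge> 2 ln n\<close> ensures \<open>m \<le> n\<close>.
\<close>

lemma defect_derivative_bound:
  "\<exists>C>0. \<forall>n u. zero_free n \<longrightarrow> 100 \<le> n \<longrightarrow> grown n u \<longrightarrow> 2 * ln n \<le> Re (defect n u mu0) \<longrightarrow>
     4 * (norm (defect n u mu0))\<^sup>2 \<le> n \<longrightarrow> norm (deriv (defect n u) mu0) \<le> C * Re (defect n u mu0) / ln n"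
proof -
  obtain C where C: "C > 0" and Cb: "\<And>f. f holomorphic_on parameter_disc \<Longrightarrow>
      (\<And>\<mu>. \<mu> \<in> parameter_disc \<Longrightarrow> f \<mu> \<noteq> 0 \<and> f \<mu> \<noteq> 1) \<Longrightarrow> norm (f mu0) \<le> 1 \<Longrightarrow> norm (deriv f mu0) \<le> C"
    using omitting_derivative_bound by blast
  have mu_in: "mu0 \<in> parameter_disc" by simp
  have main: "norm (deriv (defect n u) mu0) \<le> (3 * (4 * C + 2)) * Re (defect n u mu0) / ln n"
    if zf: "zero_free n" and n: "100 \<le> n" and u: "grown n u" and X: "2 * ln n \<le> Re (defect n u mu0)"
      and small: "4 * (norm (defect n u mu0))\<^sup>2 \<le> n" for n u
  proof -
    define z where "z = defect n u mu0"
    define X where "X = Re z"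
    have n2: "2 \<le> n" "0 < n" using n by auto
    have lnn: "2 \<le> ln (real n)"
    proof -
      have "exp 1 ^ 2 \<le> (3::real) ^ 2" using exp_le by (intro power_mono) auto
      then have "exp 2 \<le> real n" using n by (simp flip: exp_of_nat_mult)
      then show ?thesis using n2 by (simp add: ln_ge_iff)
    qed
    have X2: "2 * ln n \<le> X" "4 \<le> X" using X lnn by (simp_all add: X_def z_def)
    have Xz: "X \<le> norm z" unfolding X_def by (rule complex_Re_le_cmod)
    have z4: "4 * norm z \<le> norm z * norm z" using Xz X2 by (intro mult_right_mono) auto
    have zsq: "4 * (norm z)\<^sup>2 \<le> n" using small by (simp add: z_def)
    then have zn: "16 * norm z \<le> n" using z4 by (simp add: power2_eq_square)
    have "norm z \<le> real n / 2" using zn by linarith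
    from power_eq_exp[OF this n2(2), of 1] obtain err where
      err: "1 / (1 - z / of_nat n) = exp (of_real (1 / of_nat n) * z + err)" "norm err \<le> 2 * (norm z)\<^sup>2 / (of_nat n)\<^sup>2"
      by auto
    define a where "a = X / n + Re err"
    have norm_inv: "norm (1 / (1 - z / of_nat n)) = exp a"
      unfolding err(1) a_def X_def by (simp del: of_real_divide)
    have "\<bar>Re err\<bar> \<le> X / (2 * n)"
    proof -
      have "\<bar>Re err\<bar> \<le> 2 * (norm z)\<^sup>2 / (real n)\<^sup>2" using abs_Re_le_cmod[of err] err(2) by linarith
      also have "\<dots> \<le> (real n / 2) / (real n)\<^sup>2" using zsq by (intro divide_right_mono) auto
      also have "\<dots> = 1 / (2 * n)" using n2 by (simp add: power2_eq_square)
      also have "\<dots> \<le> X / (2 * n)" using X2 by (intro divide_right_mono) auto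
      finally show ?thesis .
    qed
    then have a: "X / (2 * n) \<le> a" "a \<le> 3 * X / (2 * n)"
      unfolding a_def by (simp_all add: abs_le_iff field_simps)
    have a0: "0 < a" 
  proof -
    have "0 < X / (2 * n)" using X2 n2 by simp
    then show ?thesis using a(1) by linarith
  qed
    have a1: "a \<le> 1"
    proof -
      have "3 * X / (2 * n) \<le> 1" using zn Xz n2 by (simp add: field_simps)
      then show ?thesis using a(2) by linarith
    qed
    \<comment> \<open>The largest number of copies for which the quotient of the weights has modulus at most \<open>n\<close>.\<close>
    define m where "m = nat \<lfloor>ln n / a\<rfloor>"
    have q: "1 \<le> ln n / a" using a0 a1 lnn by (simp add: field_simps)
    then have m: "real m \<le> ln n / a" "ln n / a - 1 < real m" unfolding m_def by linarith+
    have ma: "real m * a \<le> ln n" "ln n - a \<le> real m * a"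
      using m a0 by (simp_all add: field_simps)
    have m0: "0 < m" using q unfolding m_def by linarith
    have mn: "m \<le> n"
    proof -
      have "real m * (X / (2 * n)) \<le> ln n" using ma(1) a(1) by (meson mult_left_mono of_nat_0_le_iff order_trans)
      then have "real m * X \<le> 2 * n * ln n" using n2 by (simp add: field_simps)
      also have "\<dots> \<le> real n * X" using mult_left_mono[OF X2(1), of "real n"] by (simp add: mult_ac)
      finally show ?thesis using X2 by simp
    qed
    have m_low: "n * ln n / (3 * X) \<le> real m"
    proof -
      have "ln n / 2 \<le> ln n - a" using a1 lnn by simp
      also have "\<dots> \<le> real m * (3 * X / (2 * n))" using ma(2) a(2) by (meson mult_left_mono of_nat_0_le_iff order_trans)
      finally show ?thesis using n2 X2 by (simp add: field_simps)
    qed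
    define h where "h = target_quotient n u m"
    have hol: "defect n u holomorphic_on parameter_disc" by (rule zero_free_defect(1)[OF zf n2(1) u])
    have nz: "defect n u \<mu> \<noteq> of_nat n" if "\<mu> \<in> parameter_disc" for \<mu>
      by (rule zero_free_defect(2)[OF zf n2(1) u that])
    have h_hol: "h holomorphic_on parameter_disc"
    proof -
      have "1 - defect n u \<mu> / of_nat n \<noteq> 0" if "\<mu> \<in> parameter_disc" for \<mu>
        using nz[OF that] n2 by (simp add: field_simps)
      then show ?thesis
        unfolding h_def target_quotient_def using n2 by (intro holomorphic_intros hol) auto
    qed
    have norm_h: "norm (h mu0) = norm mu0 / n * exp (real m * a)"
      unfolding h_def target_quotient_def z_def[symmetric] norm_mult norm_power norm_inv
      by (simp add: norm_divide exp_of_nat_mult)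
    have "exp (real m * a) \<le> exp (ln n)" using ma(1) by simp
    then have "exp (real m * a) / n \<le> 1" using n2 by simp
    then have "norm mu0 * (exp (real m * a) / n) \<le> 1 * 1" by (intro mult_mono norm_mu0) auto
    then have "norm (h mu0) \<le> 1" unfolding norm_h by simp
    then have "norm (deriv h mu0) \<le> C"
      using target_quotient_omits[OF zf n2(1) u m0 mn] by (intro Cb h_hol) (auto simp: h_def)
    moreover have h_low: "1 / 4 \<le> norm (h mu0)"
    proof -
      have "real n \<le> exp (real m * a + 1)"
      proof -
        have "exp (ln n) \<le> exp (real m * a + 1)" using ma(2) a1 by simp
        then show ?thesis using n2 by simp
      qed
      also have "\<dots> \<le> exp (real m * a) * 3" using exp_le by (simp add: exp_add)
      finally have "1 / 3 \<le> exp (real m * a) / n" using n2 by (simp add: field_simps)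
      then have "9 / 10 * (1 / 3) \<le> norm mu0 * (exp (real m * a) / n)" using norm_mu0_ge by (intro mult_mono) auto
      then show ?thesis unfolding norm_h by simp
    qed
    moreover have "deriv h mu0 = h mu0 * (1 / mu0 + of_nat m * deriv (defect n u) mu0 / (of_nat n * (1 - z / of_nat n)))"
      unfolding h_def z_def
    proof (intro DERIV_imp_deriv log_derivative_target_quotient nz mu_in n2 mu0_nonzero)
      have "defect n u holomorphic_on ball mu0 (1 / 100000)" using hol by (rule holomorphic_on_subset) auto
      then show "(defect n u has_field_derivative deriv (defect n u) mu0) (at mu0)"
        by (intro holomorphic_derivI) auto
    qed
    ultimately have "norm (1 / mu0 + of_nat m * deriv (defect n u) mu0 / (of_nat n * (1 - z / of_nat n))) * (1 / 4) \<le> C"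
    proof -
      assume dh: "norm (deriv h mu0) \<le> C" and low: "1 / 4 \<le> norm (h mu0)"
        and eq: "deriv h mu0 = h mu0 * (1 / mu0 + of_nat m * deriv (defect n u) mu0 / (of_nat n * (1 - z / of_nat n)))"
      let ?q = "1 / mu0 + of_nat m * deriv (defect n u) mu0 / (of_nat n * (1 - z / of_nat n))"
      have "norm ?q * (1 / 4) \<le> norm ?q * norm (h mu0)" using low by (intro mult_left_mono) auto
      also have "\<dots> = norm (deriv h mu0)" unfolding eq norm_mult by simp
      finally show ?thesis using dh by linarith
    qed
    then have "norm (of_nat m * deriv (defect n u) mu0 / (of_nat n * (1 - z / of_nat n))) \<le> 4 * C + norm (1 / mu0)"
      using norm_triangle_ineq4[of "1 / mu0 + of_nat m * deriv (defect n u) mu0 / (of_nat n * (1 - z / of_nat n))" "1 / mu0"]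
      by simp
    also have "norm (1 / mu0) \<le> 2" using inverse_norm_mu0_le by (simp add: norm_divide)
    finally have "real m * norm (deriv (defect n u) mu0) / (real n * norm (1 - z / of_nat n)) \<le> 4 * C + 2"
      by (simp add: norm_divide norm_mult)
    moreover have "norm (1 - z / of_nat n) \<le> 1" "0 < norm (1 - z / of_nat n)"
    proof -
      have "norm (1 - z / of_nat n) = 1 / norm (1 / (1 - z / of_nat n))" by (simp add: norm_divide)
      then have "norm (1 - z / of_nat n) = exp (- a)" unfolding norm_inv by (simp add: exp_minus inverse_eq_divide)
      then show "norm (1 - z / of_nat n) \<le> 1" "0 < norm (1 - z / of_nat n)" using a0 by auto
    qed
    ultimately have "real m * norm (deriv (defect n u) mu0) \<le> (4 * C + 2) * real n"
    proof -
      let ?w = "norm (1 - z / of_nat n)"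
      assume le: "real m * norm (deriv (defect n u) mu0) / (real n * ?w) \<le> 4 * C + 2" and w: "?w \<le> 1" "0 < ?w"
      have "real m * norm (deriv (defect n u) mu0) \<le> (4 * C + 2) * (real n * ?w)"
        using le w n2 by (simp add: pos_divide_le_eq)
      also have "\<dots> \<le> (4 * C + 2) * (real n * 1)"
        using w C by (intro mult_left_mono) auto
      finally show ?thesis by simp
    qed
    moreover have "n * ln n / (3 * X) * norm (deriv (defect n u) mu0) \<le> real m * norm (deriv (defect n u) mu0)"
      using m_low by (rule mult_right_mono) simp
    ultimately have "n * ln n / (3 * X) * norm (deriv (defect n u) mu0) \<le> (4 * C + 2) * real n" by linarith
    then have "real n * (ln n / (3 * X) * norm (deriv (defect n u) mu0)) \<le> real n * (4 * C + 2)"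
      by (simp add: mult.commute)
    then have "ln n / (3 * X) * norm (deriv (defect n u) mu0) \<le> 4 * C + 2"
      by (rule mult_left_le_imp_le) (use n2 in simp)
    then show ?thesis
      unfolding z_def[symmetric] X_def[symmetric] using X2 lnn by (simp add: field_simps)
  qed
  moreover have "0 < 3 * (4 * C + 2)" using C by simp
  ultimately show ?thesis by blast
qed


section \<open>Existence of a zero\<close>

lemma defect_doubled:
  assumes "2 \<le> n" "\<mu> \<noteq> 0" "diff_wt ts (of_nat n / \<mu>) \<noteq> 0"
  shows "defect n (ts @ ts) \<mu> = 2 * defect n ts \<mu> - (defect n ts \<mu>)\<^sup>2 / \<mu>"
  using assms by (simp add: defect_def wt_append field_simps power2_eq_square)

text \<open>
  The leading term of \<open>- z\<^sup>2 / \<mu>\<^sub>0\<close> is \<open>\<rho>\<^sup>2 (3 - 4 i) / \<mu>\<^sub>0\<close>, whose real part exceeds \<open>3.6 \<rho>\<^sup>2\<close>.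
\<close>

lemma sector_square:
  assumes "in_sector \<rho> z" "1 \<le> \<rho>"
  shows "3 * \<rho>\<^sup>2 \<le> Re (2 * z - z\<^sup>2 / mu0)" "norm (2 * z - z\<^sup>2 / mu0) \<le> 12 * \<rho>\<^sup>2"
    "3 * \<rho>\<^sup>2 \<le> norm (z\<^sup>2 / mu0\<^sup>2)"
proof -
  note b = in_sector_bounds[OF assms(1)]
  define d where "d = z - of_real \<rho> * Complex 1 2"
  have d: "norm d \<le> \<rho> / 10" using assms(1) by (simp add: in_sector_def d_def)
  have z: "z = of_real \<rho> * Complex 1 2 + d" by (simp add: d_def)
  note nm = norm_mu0_ge
  have inv: "norm (w / mu0) \<le> 10 / 9 * norm w" for w
  proof -
    have "norm w / norm mu0 \<le> norm w / (9 / 10)" using nm by (intro divide_left_mono) auto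
    then show ?thesis by (simp add: norm_divide)
  qed
  define e where "e = 2 * (of_real \<rho> * Complex 1 2) * d + d\<^sup>2"
  have "norm (of_real \<rho> * Complex 1 2) \<le> \<rho> * (23 / 10)"
  proof -
    have "norm (Complex 1 2) \<le> 23 / 10" unfolding cmod_def by (rule real_le_lsqrt) (auto simp: power2_eq_square)
    then show ?thesis unfolding norm_mult norm_of_real using assms(2) by (intro mult_mono) auto
  qed
  then have "norm (2 * (of_real \<rho> * Complex 1 2)) * norm d \<le> (2 * (\<rho> * (23 / 10))) * (\<rho> / 10)"
    using d assms(2) by (intro mult_mono) (auto simp: norm_mult)
  moreover have "norm d ^ 2 \<le> (\<rho> / 10)\<^sup>2" using d by (intro power_mono) auto
  ultimately have e: "norm e \<le> 47 / 100 * \<rho>\<^sup>2"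
    unfolding e_def using norm_triangle_ineq[of "2 * (of_real \<rho> * Complex 1 2) * d" "d\<^sup>2"]
    by (simp add: norm_mult norm_power power2_eq_square)
  have sq: "z\<^sup>2 = of_real (\<rho>\<^sup>2) * Complex (- 3) 4 + e"
    unfolding z e_def by (simp add: power2_eq_square algebra_simps complex_eq_iff)
  have "Re (Complex (- 3) 4 / mu0) \<le> - 36 / 10"
    unfolding Re_divide mu0_def by (simp add: power2_eq_square)
  then have "\<rho>\<^sup>2 * Re (Complex (- 3) 4 / mu0) \<le> \<rho>\<^sup>2 * (- 36 / 10)" by (intro mult_left_mono) auto
  moreover have "Re (z\<^sup>2 / mu0) = \<rho>\<^sup>2 * Re (Complex (- 3) 4 / mu0) + Re (e / mu0)"
    unfolding sq add_divide_distrib by (simp del: of_real_power add: Re_divide_of_real flip: times_divide_eq_right)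
  moreover have "Re (e / mu0) \<le> 10 / 9 * (47 / 100 * \<rho>\<^sup>2)"
    using complex_Re_le_cmod[of "e / mu0"] inv[of e] e by linarith
  moreover have "x \<le> - 3 * r" if "a \<le> r * (- 36 / 10)" "x = a + e" "e \<le> 10 / 9 * (47 / 100 * r)" "0 \<le> r" for x a e r :: real
    using that by linarith
  ultimately have "Re (z\<^sup>2 / mu0) \<le> - 3 * \<rho>\<^sup>2" using zero_le_power2[of \<rho>] by blast
  then show "3 * \<rho>\<^sup>2 \<le> Re (2 * z - z\<^sup>2 / mu0)" using b(1) assms(2) by simp
  have z2: "norm z ^ 2 \<le> (24 / 10 * \<rho>)\<^sup>2" using b(5) by (intro power_mono) auto
  have rr: "\<rho> \<le> \<rho>\<^sup>2" using assms(2) by (simp add: power2_eq_square)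
  have "norm (2 * z - z\<^sup>2 / mu0) \<le> norm (2 * z) + norm (z\<^sup>2 / mu0)" by (rule norm_triangle_ineq4)
  also have "\<dots> \<le> 2 * (24 / 10 * \<rho>) + 10 / 9 * (24 / 10 * \<rho>)\<^sup>2"
    using b(5) z2 inv[of "z\<^sup>2"] by (intro add_mono) (auto simp: norm_mult norm_power)
  also have "\<dots> \<le> 12 * \<rho>\<^sup>2"
  proof -
    have "2 * (24 / 10 * \<rho>) + 10 / 9 * (24 / 10 * \<rho>)\<^sup>2 = 48 / 10 * \<rho> + 64 / 10 * \<rho>\<^sup>2"
      by (simp add: power_mult_distrib power2_eq_square)
    then show ?thesis using rr zero_le_power2[of \<rho>] by linarith
  qed
  finally show "norm (2 * z - z\<^sup>2 / mu0) \<le> 12 * \<rho>\<^sup>2" .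
  have "19 / 10 * \<rho> \<le> norm z" using b(3) abs_Im_le_cmod[of z] by linarith
  then have "(19 / 10 * \<rho>)\<^sup>2 \<le> norm z ^ 2" using assms(2) by (intro power_mono) auto
  moreover have "norm z ^ 2 / 1 \<le> norm z ^ 2 / norm mu0 ^ 2"
    by (rule divide_left_mono) (use norm_mu0 mu0_nonzero in \<open>auto intro: power_le_one\<close>)
  moreover have "(19 / 10 * \<rho>)\<^sup>2 = 361 / 100 * \<rho>\<^sup>2" by (simp add: power_mult_distrib power2_eq_square)
  moreover have "norm (z\<^sup>2 / mu0\<^sup>2) = norm z ^ 2 / norm mu0 ^ 2" by (simp only: norm_divide norm_power)
  ultimately show "3 * \<rho>\<^sup>2 \<le> norm (z\<^sup>2 / mu0\<^sup>2)"
    using zero_le_power2[of \<rho>] by linarith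
qed

text \<open>
  Two forests are compared whose defects \<open>z\<close> and \<open>2 z - z\<^sup>2 / \<mu>\<close> are both far beyond \<open>ln n\<close>. In a zero-free disc
  both derivatives are small relative to the defects, which the explicit factor \<open>1 / \<mu>\<close> contradicts.
\<close>

lemma eventually_not_zero_free: "\<forall>\<^sub>F n in sequentially. \<not> zero_free n"
proof -
  obtain C where C: "C > 0" and Cb: "\<And>n u. zero_free n \<Longrightarrow> 100 \<le> n \<Longrightarrow> grown n u \<Longrightarrow> 2 * ln n \<le> Re (defect n u mu0) \<Longrightarrow>
     4 * (norm (defect n u mu0))\<^sup>2 \<le> n \<Longrightarrow> norm (deriv (defect n u) mu0) \<le> C * Re (defect n u mu0) / ln n"
    using defect_derivative_bound by blast
  have "\<forall>\<^sub>F n in sequentially. 100 \<le> real n" by real_asymp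
  moreover have "\<forall>\<^sub>F n in sequentially. 10 * C < ln (real n)" by real_asymp
  moreover have "\<forall>\<^sub>F n in sequentially. 112 \<le> 3 * ln (real n)" by real_asymp
  moreover have "\<forall>\<^sub>F n in sequentially. 576 * (3 * ln (real n)) ^ 64 \<le> real n" by real_asymp
  ultimately show ?thesis using eventually_reachable_in_sector
  proof eventually_elim
    case (elim n)
    define L where "L = 3 * ln (real n)"
    have L: "112 \<le> L" "576 * L ^ 64 \<le> real n" using elim by (simp_all add: L_def)
    have n: "100 \<le> n" "2 \<le> n" "0 < n" using elim by auto
    obtain z0 where z0: "reachable n z0" "in_sector 112 z0" using elim by blast
    have L64: "L ^ 64 \<le> real n" using L zero_le_power[of L 64] by linarith
    obtain u k \<rho> where u: "grown n u" "diff_wt u (of_nat n / mu0) \<noteq> 0" and k: "0 < k" "2 * k < n"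
      and \<rho>: "L \<le> \<rho>" "\<rho> \<le> L ^ 16"
      and sec: "in_sector \<rho> (mu0 * (1 - (1 / (1 - defect n u mu0 / of_nat n)) ^ k))"
      and du: "norm (defect n u mu0) \<le> real n / 2"
      using reachable_far[OF z0 L(1) L64] by metis
    define ts where "ts = replicate k (Node u)"
    have ts_map: "ts = map Node (replicate k u)" "ts @ ts = map Node (replicate (k + k) u)"
      by (simp_all add: ts_def replicate_add)
    have grown: "grown n ts"
      unfolding ts_map(1) by (rule grown.node) (use k u(1) in auto)
    have grown2: "grown n (ts @ ts)"
      unfolding ts_map(2) by (rule grown.node) (use k u(1) in auto)
    have "norm (defect n u mu0) < norm (of_nat n :: complex)" using du n by simp
    then have "defect n u mu0 \<noteq> of_nat n" by (metis less_irrefl)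
    note R = ratio_replicate_Node[OF n(3) mu0_nonzero u(2) this grown_nonempty[OF u(1) n(2)], of k, folded ts_def]
    define z where "z = defect n ts mu0"
    have sec: "in_sector \<rho> z" using sec R(2) by (simp add: z_def defect_def)
    note b = in_sector_bounds[OF sec]
    have \<rho>1: "1 \<le> \<rho>" "112 \<le> \<rho>" using \<rho>(1) L(1) by linarith+
    have lnn: "3 * ln n \<le> \<rho>" "0 < ln n" using \<rho>(1) L(1) by (simp_all add: L_def)
    have "\<rho> ^ 4 \<le> (L ^ 16) ^ 4" using \<rho> \<rho>1 by (intro power_mono) auto
    then have \<rho>4: "576 * \<rho> ^ 4 \<le> n" using L(2) by (simp flip: power_mult)
    have \<rho>p: "\<rho>\<^sup>2 \<le> \<rho> ^ 4" "\<rho> \<le> \<rho>\<^sup>2" using \<rho>1 power_increasing[of 2 4 \<rho>] power_increasing[of 1 2 \<rho>] by auto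
    define z2 where "z2 = defect n (ts @ ts) mu0"
    have z2: "z2 = 2 * z - z\<^sup>2 / mu0"
      unfolding z2_def z_def by (rule defect_doubled[OF n(2) mu0_nonzero R(1)])
    note sq = sector_square[OF sec \<rho>1(1), folded z2]
    show ?case
    proof
      assume zf: "zero_free n"
      define D where "D = deriv (defect n ts) mu0"
      define D2 where "D2 = deriv (defect n (ts @ ts)) mu0"
      have "norm D \<le> C * Re z / ln n"
        unfolding D_def z_def
      proof (rule Cb[OF zf n(1) grown])
        show "2 * ln n \<le> Re (defect n ts mu0)" using b(1) lnn unfolding z_def[symmetric] by linarith
        have "norm z ^ 2 \<le> (24 / 10 * \<rho>)\<^sup>2" using b(5) by (intro power_mono) auto
        also have "\<dots> \<le> 6 * \<rho>\<^sup>2" by (simp add: power_mult_distrib power2_eq_square)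
        finally show "4 * (norm (defect n ts mu0))\<^sup>2 \<le> n" using \<rho>4 \<rho>p zero_le_power2[of \<rho>] unfolding z_def[symmetric] by linarith
      qed
      also have "\<dots> \<le> C * (11 / 10 * \<rho>) / ln n" using b(2) C lnn by (intro divide_right_mono mult_left_mono) auto
      finally have D: "norm D \<le> C * (11 / 10 * \<rho>) / ln n" .
      have "norm D2 \<le> C * Re z2 / ln n"
        unfolding D2_def z2_def
      proof (rule Cb[OF zf n(1) grown2])
        show "2 * ln n \<le> Re (defect n (ts @ ts) mu0)" using sq(1) lnn \<rho>p unfolding z2_def[symmetric] by linarith
        have "norm z2 ^ 2 \<le> (12 * \<rho>\<^sup>2)\<^sup>2" using sq(2) by (intro power_mono) auto
        also have "\<dots> = 144 * \<rho> ^ 4" by (simp add: power_mult_distrib flip: power_mult)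
        finally show "4 * (norm (defect n (ts @ ts) mu0))\<^sup>2 \<le> n" using \<rho>4 unfolding z2_def[symmetric] by linarith
      qed
      also have "\<dots> \<le> C * (12 * \<rho>\<^sup>2) / ln n"
        using sq(2) complex_Re_le_cmod[of z2] C lnn by (intro divide_right_mono mult_left_mono) auto
      finally have D2: "norm D2 \<le> C * (12 * \<rho>\<^sup>2) / ln n" .
      \<comment> \<open>The relation between the two defects holds near \<open>\<mu>\<^sub>0\<close>, so it can be differentiated.\<close>
      have rel: "D2 = 2 * D - 2 * z * D / mu0 + z\<^sup>2 / mu0\<^sup>2"
      proof -
        have hol: "defect n v holomorphic_on ball mu0 (1 / 100000)" if "grown n v" for v
          using zero_free_defect(1)[OF zf n(2) that] by (rule holomorphic_on_subset) auto
        have der: "(defect n ts has_field_derivative D) (at mu0)"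
          unfolding D_def by (rule holomorphic_derivI[OF hol[OF grown]]) auto
        have "((\<lambda>\<mu>. 2 * defect n ts \<mu> - (defect n ts \<mu>)\<^sup>2 / \<mu>) has_field_derivative
            2 * D - 2 * z * D / mu0 + z\<^sup>2 / mu0\<^sup>2) (at mu0)"
          by (rule derivative_eq_intros der refl mu0_nonzero)+
            (use mu0_nonzero in \<open>simp add: z_def power2_eq_square field_simps\<close>)
        moreover have "\<forall>\<^sub>F \<mu> in nhds mu0. defect n (ts @ ts) \<mu> = 2 * defect n ts \<mu> - (defect n ts \<mu>)\<^sup>2 / \<mu>"
        proof -
          have "\<forall>\<^sub>F \<mu> in nhds mu0. \<mu> \<in> ball mu0 (1 / 100000)"
            by (intro eventually_nhds_in_open) auto
          then show ?thesis
          proof eventually_elim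
            case (elim \<mu>)
            then have \<mu>: "\<mu> \<in> parameter_disc" by simp
            show ?case
              using defect_doubled[OF n(2) parameter_disc_facts(1)[OF \<mu>]] zero_free_weights_nonzero[OF zf n(2) \<mu> grown] by blast
          qed
        qed
        ultimately have "(defect n (ts @ ts) has_field_derivative 2 * D - 2 * z * D / mu0 + z\<^sup>2 / mu0\<^sup>2) (at mu0)"
          by (subst DERIV_cong_ev[OF refl _ refl])
        then show ?thesis unfolding D2_def by (rule DERIV_imp_deriv)
      qed
      have "z\<^sup>2 / mu0\<^sup>2 = D2 - 2 * D + 2 * z * D / mu0" using rel by (simp add: algebra_simps)
      then have "norm (z\<^sup>2 / mu0\<^sup>2) \<le> norm D2 + norm (2 * D) + norm (2 * z * D / mu0)"
        by (metis norm_triangle_ineq norm_triangle_ineq4 norm_triangle_mono order_refl)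
      also have "norm (2 * D) = 2 * norm D" by (simp add: norm_mult)
      also have "norm (2 * z * D / mu0) \<le> 2 * (24 / 10 * \<rho>) * norm D * (10 / 9)"
      proof -
        have "norm (2 * z * D / mu0) = (2 * norm z * norm D) * (1 / norm mu0)" by (simp add: norm_divide norm_mult)
        also have "\<dots> \<le> 2 * (24 / 10 * \<rho>) * norm D * (10 / 9)"
          using b(5) \<rho>1 by (intro mult_mono inverse_norm_mu0_le) auto
        finally show ?thesis .
      qed
      finally have "3 * \<rho>\<^sup>2 \<le> norm D2 + (2 + 16 / 3 * \<rho>) * norm D" using sq(3) by (simp add: algebra_simps)
      also have "(2 + 16 / 3 * \<rho>) * norm D \<le> (6 * \<rho>) * (C * (11 / 10 * \<rho>) / ln n)"
        using D \<rho>1 by (intro mult_mono) auto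
      also note D2
      finally have "3 * \<rho>\<^sup>2 \<le> C * (12 * \<rho>\<^sup>2) / ln n + (6 * \<rho>) * (C * (11 / 10 * \<rho>) / ln n)" by simp
      also have "\<dots> = 186 / 10 * C * \<rho>\<^sup>2 / ln n" by (simp add: power2_eq_square field_simps)
      finally have "3 * ln n * \<rho>\<^sup>2 \<le> 186 / 10 * C * \<rho>\<^sup>2" using lnn by (simp add: field_simps)
      moreover have "0 < \<rho>\<^sup>2" using \<rho>1 by simp
      ultimately have "3 * ln n \<le> 186 / 10 * C" by (rule mult_right_le_imp_le)
      then show False using elim(2) C by linarith
    qed
  qed
qed

theorem theorem4:
  shows "\<exists>\<Delta>\<^sub>0::nat. \<Delta>\<^sub>0 > 0 \<and>
    (\<forall>\<Delta>::nat. \<Delta> \<ge> \<Delta>\<^sub>0 \<longrightarrow>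
      (\<exists>(T :: (nat, nat) multigraph) (v :: nat) (q :: complex).
         rooted_tree T v \<and> max_degree T = \<Delta> \<and>
         Re q > real \<Delta> \<and> chromatic_poly (leaf_joined_tree T v) q = 0))"
proof -
  obtain N where N: "\<And>n. N \<le> n \<Longrightarrow> \<not> zero_free n"
    using eventually_not_zero_free unfolding eventually_sequentially by blast
  show ?thesis
  proof (intro exI[of _ "N + 2"] conjI allI impI)
    fix n :: nat assume n: "N + 2 \<le> n"
    then obtain \<mu> us where \<mu>: "\<mu> \<in> parameter_disc" and us: "us \<noteq> []" "length us \<le> n" "\<forall>u\<in>set us. grown n u"
      and zero: "same_wt (map Node us) (of_nat n / \<mu>) + of_nat n / \<mu> * diff_wt (map Node us) (of_nat n / \<mu>) = 0"
      using N[of n] unfolding zero_free_def by auto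
    define q where "q = 1 + of_nat n / \<mu>"
    let ?T = "tree_graph (map Node us)"
    have "chromatic_poly (leaf_joined_tree ?T 0) q
        = q * (same_wt (map Node us) (q - 1) + (q - 1) * diff_wt (map Node us) (q - 1))"
      using us(1) by (subst chromatic_poly_leaf_joined_tree) (auto simp: algebra_simps)
    then have "chromatic_poly (leaf_joined_tree ?T 0) q = 0" using zero by (simp add: q_def)
    moreover have "real n < Re q"
    proof -
      have "real n * 1 \<le> real n * Re (1 / \<mu>)" using parameter_disc_facts(3)[OF \<mu>] by (intro mult_left_mono) auto
      also have "\<dots> = Re (of_nat n / \<mu>)" by (simp add: Re_divide)
      finally show ?thesis by (simp add: q_def)
    qed
    moreover have "rooted_tree ?T 0" by (simp add: rooted_tree_def is_tree_tree_graph)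
    moreover have "max_degree ?T = n" using us n by (intro max_degree_grown) auto
    ultimately show "\<exists>(T :: (nat, nat) multigraph) (v :: nat) (q :: complex).
         rooted_tree T v \<and> max_degree T = n \<and> Re q > real n \<and> chromatic_poly (leaf_joined_tree T v) q = 0"
      by blast
  qed simp
qed

end
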